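(* There exist constants $C_1,C_2<0$ such that, for every integer $N\geq 2$, $$C_1N^2\leq \mathcal{E}_2(\mathbb{S}^2,N)-\frac14 N^2\log N\leq C_2N^2.$$
   Context: $\mathbb{S}^2\subset\mathbb{R}^3$ is the unit sphere. For a set $\omega_N=\{x_1,\dots,x_N\}\subset\mathbb{S}^2$ of $N$ distinct points, $E_2(\omega_N)=\sum_{i\neq j}\|x_i-x_j\|^{-2}$ (sum over ordered pairs of distinct indices, Euclidean norm), and $\mathcal{E}_2(\mathbb{S}^2,N)=\min\{E_2(\omega_N):\omega_N\subset\mathbb{S}^2\}$ is the minimal Riesz $2$-energy of $N$ points. *)

theory Defs
  imports "HOL-Analysis.Analysis"
begin

definition riesz_2_energy :: "(real ^ 3) set \<Rightarrow> real" where
  "riesz_2_energy \<omega> = (\<Sum>(x, y) \<in> {(x, y). x \<in> \<omega> \<and> y \<in> \<omega> \<and> x \<noteq> y}. 1 / (norm (x - y))\<^sup>2)"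

definition sphere_configs :: "nat \<Rightarrow> (real ^ 3) set set" where
  "sphere_configs N = {\<omega>. \<omega> \<subseteq> sphere 0 1 \<and> finite \<omega> \<and> card \<omega> = N}"

text \<open>The minimum is written as an infimum; by the theorem \<open>min_riesz_2_energy_attained\<close> below
  it is attained for every \<open>N\<close>.\<close>

definition min_riesz_2_energy :: "nat \<Rightarrow> real" where
  "min_riesz_2_energy N = (INF \<omega> \<in> sphere_configs N. riesz_2_energy \<omega>)"

lemma riesz_2_energy_image:
  assumes "inj_on x {..<N}"
  shows "riesz_2_energy (x ` {..<N})
    = (\<Sum>(i, j) \<in> {(i, j). i < N \<and> j < N \<and> i \<noteq> j}. 1 / (norm (x i - x j))\<^sup>2)"
  unfolding riesz_2_energy_def
proof (rule sum.reindex_cong [where l = "map_prod x x"])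
  show "inj_on (map_prod x x) {(i, j). i < N \<and> j < N \<and> i \<noteq> j}"
    using assms by (auto simp: inj_on_def)
  show "{(u, v). u \<in> x ` {..<N} \<and> v \<in> x ` {..<N} \<and> u \<noteq> v}
    = map_prod x x ` {(i, j). i < N \<and> j < N \<and> i \<noteq> j}"
    using assms by (auto simp: inj_on_def image_iff)
qed auto

lemma sphere_configs_nonempty: "sphere_configs N \<noteq> {}"
proof -
  have "connected (sphere (0 :: real ^ 3) 1)"
    by (rule connected_sphere) simp
  moreover have "axis 1 1 \<in> sphere (0 :: real ^ 3) 1" "- axis 1 1 \<in> sphere (0 :: real ^ 3) 1"
    by (auto simp: norm_axis_1)
  moreover have "axis 1 1 \<noteq> - (axis 1 1 :: real ^ 3)"
    by (auto simp: vec_eq_iff axis_def intro!: exI [of _ 1])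
  ultimately have "uncountable (sphere (0 :: real ^ 3) 1)"
    by (rule connected_uncountable)
  then have "infinite (sphere (0 :: real ^ 3) 1)"
    by (rule uncountable_infinite)
  then obtain T where "T \<subseteq> sphere (0 :: real ^ 3) 1" "finite T" "card T = N"
    using infinite_arbitrarily_large by metis
  then show ?thesis
    by (auto simp: sphere_configs_def)
qed

theorem min_riesz_2_energy_attained:
  obtains \<omega> where "\<omega> \<in> sphere_configs N" "riesz_2_energy \<omega> = min_riesz_2_energy N"
    "\<And>\<omega>'. \<omega>' \<in> sphere_configs N \<Longrightarrow> riesz_2_energy \<omega> \<le> riesz_2_energy \<omega>'"
proof -
  define P where "P = {(i, j). i < N \<and> j < N \<and> i \<noteq> j}"
  define F :: "(nat \<Rightarrow> real ^ 3) \<Rightarrow> real" where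
    "F x = (\<Sum>(i, j) \<in> P. 1 / (norm (x i - x j))\<^sup>2)" for x
  have "finite P"
    by (rule finite_subset [of _ "{..<N} \<times> {..<N}"]) (auto simp: P_def)
  have param: "\<exists>x. inj_on x {..<N} \<and> (\<forall>i. x i \<in> sphere 0 1) \<and> \<omega> = x ` {..<N}
      \<and> riesz_2_energy \<omega> = F x" if \<omega>: "\<omega> \<in> sphere_configs N" for \<omega>
  proof -
    obtain h where h: "bij_betw h {..<N} \<omega>"
      using \<omega> ex_bij_betw_nat_finite [of \<omega>] by (auto simp: sphere_configs_def atLeast0LessThan)
    define x where "x i = (if i < N then h i else axis 1 1)" for i
    have "inj_on x {..<N}" "x ` {..<N} = \<omega>"
      using h by (auto simp: bij_betw_def x_def inj_on_def image_iff)
    moreover have "x i \<in> sphere 0 1" for i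
      using \<omega> h by (auto simp: x_def sphere_configs_def bij_betw_def norm_axis_1 subset_iff)
    ultimately show ?thesis
      using riesz_2_energy_image [of x N] by (auto simp: F_def P_def)
  qed
  obtain \<omega>0 where \<omega>0: "\<omega>0 \<in> sphere_configs N"
    using sphere_configs_nonempty [of N] by auto
  obtain x0 :: "nat \<Rightarrow> real ^ 3" where x0: "inj_on x0 {..<N}" "\<And>i. x0 i \<in> sphere 0 1"
    using param [OF \<omega>0] by blast
  define M where "M = max 1 (F x0)"
  have "M > 0" by (simp add: M_def)
  define K where "K = (\<Pi>\<^sub>E i\<in>UNIV. sphere (0 :: real ^ 3) 1)
    \<inter> (\<Inter>(i, j)\<in>P. {x. 1 / M \<le> (norm (x i - x j))\<^sup>2})"
  have in_K: "x \<in> K" if "inj_on x {..<N}" "\<And>i. x i \<in> sphere 0 1" "F x \<le> M" for x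
  proof -
    have "1 / M \<le> (norm (x i - x j))\<^sup>2" if ij: "(i, j) \<in> P" for i j
    proof -
      have "1 / (norm (x i - x j))\<^sup>2 \<le> F x"
        unfolding F_def
        using member_le_sum [OF ij, of "\<lambda>(i, j). 1 / (norm (x i - x j))\<^sup>2"] \<open>finite P\<close> by auto
      then have "1 / (norm (x i - x j))\<^sup>2 \<le> M"
        using \<open>F x \<le> M\<close> by simp
      moreover have "x i \<noteq> x j"
        using ij \<open>inj_on x {..<N}\<close> by (auto simp: P_def inj_on_def)
      ultimately show ?thesis
        using \<open>M > 0\<close> by (simp add: field_simps)
    qed
    then show ?thesis
      using that by (auto simp: K_def)
  qed
  have coord: "continuous_on A (\<lambda>x :: nat \<Rightarrow> real ^ 3. x i)" for A i
    by (rule continuous_on_subset [OF continuous_on_product_coordinates]) auto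
  have "compact (\<Pi>\<^sub>E i\<in>(UNIV :: nat set). sphere (0 :: real ^ 3) 1)"
    using compactin_PiE [of "\<lambda>_. euclidean :: (real ^ 3) topology" "UNIV :: nat set" "\<lambda>_. sphere 0 1"]
    by (simp add: euclidean_product_topology)
  moreover have "closed (\<Inter>(i, j)\<in>P. {x :: nat \<Rightarrow> real ^ 3. 1 / M \<le> (norm (x i - x j))\<^sup>2})"
    by (auto intro!: closed_INT closed_Collect_le continuous_intros coord)
  ultimately have "compact K"
    unfolding K_def by (rule compact_Int_closed)
  moreover have "K \<noteq> {}"
    using in_K [of x0] x0 by (auto simp: M_def)
  moreover have "continuous_on K F"
    unfolding F_def
  proof (intro continuous_on_sum, clarify)
    fix i j assume "(i, j) \<in> P"
    then have "norm (x i - x j) \<noteq> 0" if "x \<in> K" for x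
      using that \<open>M > 0\<close> by (fastforce simp: K_def)
    then show "continuous_on K (\<lambda>x. 1 / (norm (x i - x j))\<^sup>2)"
      by (intro continuous_intros coord) auto
  qed
  ultimately obtain y where y: "y \<in> K" "\<And>x. x \<in> K \<Longrightarrow> F y \<le> F x"
    using continuous_attains_inf [of K F] by auto
  have inj: "inj_on y {..<N}"
  proof (rule inj_onI, rule ccontr)
    fix i j assume "i \<in> {..<N}" "j \<in> {..<N}" "y i = y j" "i \<noteq> j"
    then show False
      using y(1) \<open>M > 0\<close> by (fastforce simp: K_def P_def)
  qed
  let ?\<omega> = "y ` {..<N}"
  have "?\<omega> \<in> sphere_configs N"
    using inj y(1) by (auto simp: sphere_configs_def card_image K_def PiE_iff)
  moreover have "riesz_2_energy ?\<omega> \<le> riesz_2_energy \<omega>'" if \<omega>': "\<omega>' \<in> sphere_configs N" for \<omega>'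
  proof -
    obtain x where x: "inj_on x {..<N}" "\<And>i. x i \<in> sphere 0 1" "riesz_2_energy \<omega>' = F x"
      using param [OF \<omega>'] by blast
    have "F y \<le> F x0"
      using in_K [of x0] x0 y(2) by (auto simp: M_def)
    then have "F y \<le> F x"
      using in_K [of x] x y(2) by (cases "F x \<le> M") (auto simp: M_def)
    then show ?thesis
      using x riesz_2_energy_image [OF inj] by (simp add: F_def P_def)
  qed
  moreover from calculation have "riesz_2_energy ?\<omega> = min_riesz_2_energy N"
    unfolding min_riesz_2_energy_def
    by (intro cInf_eq_minimum [symmetric]) auto
  ultimately show ?thesis
    using that by blast
qed

end

theory Submission
  imports Defs
begin

text \<open>Put \<open>w = (1 + x \<bullet> y) / 2\<close> for unit vectors, so that \<open>norm (x - y)\<^sup>2 = 4 * (1 - w)\<close>.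

Lower bound. The sphere is the complex projective line: \<open>w\<close> is the squared modulus of the inner product
of two unit spinors, so \<open>w ^ k\<close> is that of their \<open>k\<close>-th tensor powers, which live in the symmetric
power of dimension \<open>k + 1\<close>. A Gram matrix of rank at most \<open>k + 1\<close> and trace \<open>N\<close> has squared
Hilbert--Schmidt norm at least \<open>N\<^sup>2 / (k + 1)\<close>, that is, the sum of \<open>w ^ k\<close> over all ordered pairs is at
least \<open>N\<^sup>2 / (k + 1)\<close> (\<open>sum_half_inner_power_ge\<close>). Since \<open>1 / (1 - w)\<close> dominates the first \<open>N\<close> terms of
the geometric series, summation over \<open>k < N\<close> and removal of the diagonal, which contributes \<open>N\<^sup>2\<close>, give
the energy bound \<open>N\<^sup>2 / 4 * (H\<^sub>N - 1)\<close>, where \<open>H\<^sub>N\<close> is the harmonic number.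

Upper bound. The average of \<open>1 / norm (x - y)\<^sup>2\<close> over all rotations of \<open>y\<close> about the vertical axis is exactly
\<open>1 / (2 * \<bar>z - z'\<bar>)\<close> for the heights \<open>z \<noteq> z'\<close> of \<open>x\<close> and \<open>y\<close>. If equally spaced points are placed on
several parallels and the parallels are rotated one after the other, each rotation can be chosen no worse
than its average. So some configuration has at most the energy of a one-dimensional problem
(\<open>rotated_rings\<close>), in which a ring of \<open>r\<close> points at height \<open>z\<close> has the self-energy
\<open>r * (r\<^sup>2 - 1) / (12 * (1 - z\<^sup>2))\<close> (\<open>riesz_2_energy_ring\<close>).

With \<open>4 * j\<close> points at each of the heights \<open>\<plusminus> (1 - j\<^sup>2 / m\<^sup>2)\<close>, \<open>1 \<le> j \<le> m\<close>, there are \<open>N = 4 * m\<^sup>2\<close> points. The sums over pairs of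
rings reduce to harmonic numbers on one hemisphere and are bounded by convexity across the equator.
The resulting bound is \<open>N\<^sup>2 / 4 * (ln N - \<delta> + o(1))\<close> with \<open>\<delta> = ln 4 + 1 - 2 * \<gamma> - 4 / 3 * ln 2\<close>, which is
about \<open>0.308\<close> and thus positive.

The quotient of the minimal energy by \<open>N * (N - 1)\<close> is nondecreasing in \<open>N\<close>, because deleting a point of
a minimal configuration removes on average its share of the energy. Hence a bound for \<open>4 * m\<^sup>2\<close> points
is inherited by all \<open>N\<close> between \<open>4 * (m - 1)\<^sup>2\<close> and \<open>4 * m\<^sup>2\<close> at the cost of \<open>2 * ln (m / (m - 1))\<close> in the
bracket, which stays below \<open>\<delta>\<close> with room for the lower order terms from \<open>m = 12\<close> on. The finitely many
\<open>N \<le> 484 = 4 * 11\<^sup>2\<close> are covered in the same way by fifteen explicit systems of rings, whose energies are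
rational numbers.\<close>

section \<open>The energy of every configuration is at least \<open>N\<^sup>2 / 4 * (ln N - 1)\<close>\<close>

text \<open>With \<open>A\<close> the matrix of the vectors \<open>(e l x)\<close>, the Hilbert--Schmidt norms of \<open>A * A\<^sup>*\<close> (indexed by \<open>S\<close>) and of
\<open>A\<^sup>* * A\<close> (indexed by \<open>{..k}\<close>) agree, and the latter is at least what the \<open>k + 1\<close> diagonal entries, of sum
\<open>card S\<close>, force by Cauchy--Schwarz.\<close>

lemma card_square_le_gram_sum:
  fixes e :: "nat \<Rightarrow> 'a \<Rightarrow> complex"
  assumes fin: "finite S" and unit: "\<And>x. x \<in> S \<Longrightarrow> (\<Sum>l\<le>k. (cmod (e l x))\<^sup>2) = 1"
  shows "(real (card S))\<^sup>2 / (real k + 1)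
    \<le> (\<Sum>x\<in>S. \<Sum>y\<in>S. (cmod (\<Sum>l\<le>k. e l x * cnj (e l y)))\<^sup>2)"
proof -
  define F where "F l l' = (\<Sum>x\<in>S. e l x * cnj (e l' x))" for l l'
  have "complex_of_real (\<Sum>x\<in>S. \<Sum>y\<in>S. (cmod (\<Sum>l\<le>k. e l x * cnj (e l y)))\<^sup>2)
    = (\<Sum>x\<in>S. \<Sum>y\<in>S. (\<Sum>l\<le>k. e l x * cnj (e l y)) * cnj (\<Sum>l\<le>k. e l x * cnj (e l y)))"
    by (simp only: of_real_sum complex_norm_square)
  also have "\<dots> = (\<Sum>x\<in>S. \<Sum>y\<in>S. \<Sum>l\<le>k. \<Sum>l'\<le>k.
      (e l x * cnj (e l' x)) * cnj (e l y * cnj (e l' y)))"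
    by (simp add: sum_product mult_ac)
  also have "\<dots> = (\<Sum>x\<in>S. \<Sum>l\<le>k. \<Sum>y\<in>S. \<Sum>l'\<le>k.
      (e l x * cnj (e l' x)) * cnj (e l y * cnj (e l' y)))"
    by (rule sum.cong [OF refl], rule sum.swap)
  also have "\<dots> = (\<Sum>l\<le>k. \<Sum>x\<in>S. \<Sum>y\<in>S. \<Sum>l'\<le>k.
      (e l x * cnj (e l' x)) * cnj (e l y * cnj (e l' y)))"
    by (rule sum.swap)
  also have "\<dots> = (\<Sum>l\<le>k. \<Sum>x\<in>S. \<Sum>l'\<le>k. \<Sum>y\<in>S.
      (e l x * cnj (e l' x)) * cnj (e l y * cnj (e l' y)))"
    by (intro sum.cong [OF refl], rule sum.swap)
  also have "\<dots> = (\<Sum>l\<le>k. \<Sum>l'\<le>k. \<Sum>x\<in>S. \<Sum>y\<in>S.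
      (e l x * cnj (e l' x)) * cnj (e l y * cnj (e l' y)))"
    by (intro sum.cong [OF refl], rule sum.swap)
  also have "\<dots> = (\<Sum>l\<le>k. \<Sum>l'\<le>k. F l l' * cnj (F l l'))"
    by (simp add: F_def sum_product)
  also have "\<dots> = complex_of_real (\<Sum>l\<le>k. \<Sum>l'\<le>k. (cmod (F l l'))\<^sup>2)"
    by (simp only: of_real_sum complex_norm_square)
  finally have gram: "(\<Sum>x\<in>S. \<Sum>y\<in>S. (cmod (\<Sum>l\<le>k. e l x * cnj (e l y)))\<^sup>2)
    = (\<Sum>l\<le>k. \<Sum>l'\<le>k. (cmod (F l l'))\<^sup>2)"
    by (simp only: of_real_eq_iff)
  have diag: "F l l = complex_of_real (\<Sum>x\<in>S. (cmod (e l x))\<^sup>2)" for l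
    by (simp only: F_def of_real_sum complex_norm_square)
  have "real (card S) = (\<Sum>x\<in>S. \<Sum>l\<le>k. (cmod (e l x))\<^sup>2)"
    using unit by simp
  also have "\<dots> = (\<Sum>l\<le>k. \<Sum>x\<in>S. (cmod (e l x))\<^sup>2)"
    by (rule sum.swap)
  also have "\<dots> = (\<Sum>l\<le>k. cmod (F l l))"
    by (rule sum.cong [OF refl], simp only: diag norm_of_real)
       (simp add: abs_of_nonneg sum_nonneg)
  finally have "(real (card S))\<^sup>2 = (\<Sum>l\<le>k. cmod (F l l))\<^sup>2" by simp
  also have "\<dots> \<le> (\<Sum>l\<le>k. (cmod (F l l))\<^sup>2) * (\<Sum>l\<le>k. 1\<^sup>2)"
    using Cauchy_Schwarz_ineq_sum [of "\<lambda>l. cmod (F l l)" "\<lambda>_. 1" "{..k}"] by simp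
  finally have "(real (card S))\<^sup>2 / (real k + 1) \<le> (\<Sum>l\<le>k. (cmod (F l l))\<^sup>2)"
    by (simp add: field_simps)
  also have "\<dots> \<le> (\<Sum>l\<le>k. \<Sum>l'\<le>k. (cmod (F l l'))\<^sup>2)"
    by (intro sum_mono member_le_sum [of l _ "\<lambda>l'. (cmod (F l l'))\<^sup>2" for l]) auto
  finally show ?thesis using gram by simp
qed

text \<open>The inverse of the Hopf map: the point \<open>x\<close> corresponds to the complex line spanned by \<open>(a, b)\<close>.\<close>

lemma spinor_exists:
  fixes x :: "real ^ 3"
  assumes "norm x = 1"
  obtains a b :: complex where "(cmod a)\<^sup>2 = (1 + x $ 3) / 2" "(cmod b)\<^sup>2 = (1 - x $ 3) / 2"
    "2 * cnj a * b = Complex (x $ 1) (x $ 2)"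
proof -
  have sq: "(x $ 1)\<^sup>2 + (x $ 2)\<^sup>2 + (x $ 3)\<^sup>2 = 1"
    using assms by (simp add: norm_eq_1 inner_vec_def sum_3 power2_eq_square)
  show ?thesis
  proof (cases "x $ 3 = -1")
    case True
    with sq have "x $ 1 = 0" "x $ 2 = 0" by auto
    with True show ?thesis
      by (intro that [of 0 1]) (auto simp: complex_eq_iff)
  next
    case False
    have "(x $ 3)\<^sup>2 \<le> 1" using sq by (smt (verit) zero_le_power2)
    then have pos: "1 + x $ 3 > 0" using False by (simp add: abs_square_le_1 abs_le_iff)
    define s where "s = sqrt ((1 + x $ 3) / 2)"
    have s: "s > 0" "s\<^sup>2 = (1 + x $ 3) / 2" using pos by (auto simp: s_def)
    show ?thesis
    proof (rule that [of "of_real s" "Complex (x $ 1) (x $ 2) / (2 * of_real s)"])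
      show "(cmod (of_real s))\<^sup>2 = (1 + x $ 3) / 2" using s by simp
      have "(cmod (Complex (x $ 1) (x $ 2) / (2 * of_real s)))\<^sup>2
        = ((x $ 1)\<^sup>2 + (x $ 2)\<^sup>2) / (4 * s\<^sup>2)"
        using s(1) by (simp add: norm_divide power_divide cmod_power2 norm_mult power_mult_distrib)
      also have "(x $ 1)\<^sup>2 + (x $ 2)\<^sup>2 = 1 - (x $ 3)\<^sup>2"
        using sq by simp
      also have "4 * s\<^sup>2 = 2 * (1 + x $ 3)"
        using s(2) by simp
      also have "(1 - (x $ 3)\<^sup>2) / (2 * (1 + x $ 3)) = (1 - x $ 3) / 2"
        using pos by (simp add: field_simps power2_eq_square)
      finally show "(cmod (Complex (x $ 1) (x $ 2) / (2 * of_real s)))\<^sup>2 = (1 - x $ 3) / 2" .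
      show "2 * cnj (of_real s) * (Complex (x $ 1) (x $ 2) / (2 * of_real s)) = Complex (x $ 1) (x $ 2)"
        using s by simp
    qed
  qed
qed

lemma spinor_product:
  fixes x y :: "real ^ 3" and a b a' b' :: complex
  assumes "(cmod a)\<^sup>2 = (1 + x $ 3) / 2" "(cmod b)\<^sup>2 = (1 - x $ 3) / 2"
    "2 * cnj a * b = Complex (x $ 1) (x $ 2)"
    "(cmod a')\<^sup>2 = (1 + y $ 3) / 2" "(cmod b')\<^sup>2 = (1 - y $ 3) / 2"
    "2 * cnj a' * b' = Complex (y $ 1) (y $ 2)"
  shows "(cmod (a * cnj a' + b * cnj b'))\<^sup>2 = (1 + x \<bullet> y) / 2"
proof -
  have "(cmod (a * cnj a' + b * cnj b'))\<^sup>2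
    = (cmod a)\<^sup>2 * (cmod a')\<^sup>2 + (cmod b)\<^sup>2 * (cmod b')\<^sup>2
      + Re ((2 * cnj a' * b') * cnj (2 * cnj a * b)) / 2"
    unfolding cmod_power2 by (simp add: field_simps power2_eq_square)
  also have "\<dots> = (1 + x \<bullet> y) / 2"
    unfolding assms by (simp add: inner_vec_def sum_3 field_simps)
  finally show ?thesis .
qed

text \<open>The monomials \<open>sqrt (k choose l) * a ^ l * b ^ (k - l)\<close> are the coordinates of the \<open>k\<close>-th tensor power of
the spinor \<open>(a, b)\<close> in an orthonormal basis of the symmetric power. Equality would hold for the uniform measure,
as \<open>w\<close> is then uniformly distributed on \<open>[0, 1]\<close>.\<close>

lemma sum_half_inner_power_ge:
  fixes S :: "(real ^ 3) set"
  assumes "finite S" "S \<subseteq> sphere 0 1"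
  shows "(real (card S))\<^sup>2 / (real k + 1) \<le> (\<Sum>x\<in>S. \<Sum>y\<in>S. ((1 + x \<bullet> y) / 2) ^ k)"
proof -
  have "\<forall>x\<in>S. \<exists>a b. (cmod a)\<^sup>2 = (1 + x $ 3) / 2 \<and> (cmod b)\<^sup>2 = (1 - x $ 3) / 2
    \<and> 2 * cnj a * b = Complex (x $ 1) (x $ 2)"
  proof
    fix x assume "x \<in> S"
    then have "norm x = 1" using assms by auto
    then show "\<exists>a b. (cmod a)\<^sup>2 = (1 + x $ 3) / 2 \<and> (cmod b)\<^sup>2 = (1 - x $ 3) / 2
      \<and> 2 * cnj a * b = Complex (x $ 1) (x $ 2)"
      using spinor_exists by metis
  qed
  then obtain a b where ab: "\<And>x. x \<in> S \<Longrightarrow> (cmod (a x))\<^sup>2 = (1 + x $ 3) / 2"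
    "\<And>x. x \<in> S \<Longrightarrow> (cmod (b x))\<^sup>2 = (1 - x $ 3) / 2"
    "\<And>x. x \<in> S \<Longrightarrow> 2 * cnj (a x) * b x = Complex (x $ 1) (x $ 2)"
    by metis
  define e where "e l x = of_real (sqrt (real (k choose l))) * a x ^ l * b x ^ (k - l)" for l x
  have binom: "(\<Sum>l\<le>k. e l x * cnj (e l y)) = (a x * cnj (a y) + b x * cnj (b y)) ^ k" for x y
  proof -
    have "e l x * cnj (e l y)
      = of_nat (k choose l) * (a x * cnj (a y)) ^ l * (b x * cnj (b y)) ^ (k - l)" for l
    proof -
      have "complex_of_real (sqrt (real (k choose l))) * of_real (sqrt (real (k choose l)))
        = of_nat (k choose l)"
        by (simp flip: of_real_mult)
      then show ?thesis
        by (simp add: e_def power_mult_distrib mult_ac)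
    qed
    then show ?thesis by (simp add: binomial_ring)
  qed
  have prod: "(cmod (\<Sum>l\<le>k. e l x * cnj (e l y)))\<^sup>2 = ((1 + x \<bullet> y) / 2) ^ k"
    if "x \<in> S" "y \<in> S" for x y
  proof -
    have "(cmod (\<Sum>l\<le>k. e l x * cnj (e l y)))\<^sup>2 = ((cmod (a x * cnj (a y) + b x * cnj (b y)))\<^sup>2) ^ k"
      by (simp only: binom norm_power power_mult [symmetric] mult.commute)
    also have "(cmod (a x * cnj (a y) + b x * cnj (b y)))\<^sup>2 = (1 + x \<bullet> y) / 2"
      by (rule spinor_product) (intro ab that)+
    finally show ?thesis .
  qed
  have "(\<Sum>l\<le>k. (cmod (e l x))\<^sup>2) = 1" if x: "x \<in> S" for x
  proof -
    have "complex_of_real (\<Sum>l\<le>k. (cmod (e l x))\<^sup>2) = (a x * cnj (a x) + b x * cnj (b x)) ^ k"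
      by (simp only: of_real_sum complex_norm_square binom)
    also have "a x * cnj (a x) + b x * cnj (b x) = of_real ((cmod (a x))\<^sup>2 + (cmod (b x))\<^sup>2)"
      by (simp only: of_real_add complex_norm_square)
    also have "(cmod (a x))\<^sup>2 + (cmod (b x))\<^sup>2 = 1"
      using ab(1,2) [OF x] by (simp add: field_simps)
    also have "complex_of_real 1 ^ k = of_real 1"
      by simp
    finally show ?thesis by (simp only: of_real_eq_iff)
  qed
  from card_square_le_gram_sum [OF assms(1) this] show ?thesis
    using prod by simp
qed

lemma riesz_2_energy_iterated_sum:
  assumes "finite S"
  shows "riesz_2_energy S = (\<Sum>x\<in>S. \<Sum>y\<in>S - {x}. 1 / (norm (x - y))\<^sup>2)"
proof -
  have "{(x, y). x \<in> S \<and> y \<in> S \<and> x \<noteq> y} = Sigma S (\<lambda>x. S - {x})" by auto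
  then show ?thesis
    unfolding riesz_2_energy_def using assms by (simp add: sum.Sigma)
qed

theorem riesz_2_energy_lower_bound:
  assumes "finite S" "S \<subseteq> sphere 0 1"
  defines "N \<equiv> card S"
  shows "(real N)\<^sup>2 / 4 * (harm N - 1) \<le> riesz_2_energy S"
proof -
  define w where "w x y = (1 + x \<bullet> y) / 2" for x y :: "real ^ 3"
  have unit: "norm x = 1" if "x \<in> S" for x using assms(2) that by auto
  have w: "(\<Sum>k<N. w x y ^ k) / 4 \<le> 1 / (norm (x - y))\<^sup>2" if "x \<in> S" "y \<in> S" "x \<noteq> y" for x y
  proof -
    have d: "(norm (x - y))\<^sup>2 = 4 * (1 - w x y)"
      using unit that by (simp add: w_def norm_eq_1 power2_norm_eq_inner inner_diff inner_commute field_simps)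
    then have lt: "w x y < 1" using that
      by (smt (verit) right_minus_eq zero_less_norm_iff zero_less_power)
    have "x \<bullet> y \<ge> - 1"
      using Cauchy_Schwarz_ineq2 [of x y] unit that by auto
    then have "w x y \<ge> 0" by (simp add: w_def)
    then have "(\<Sum>k<N. w x y ^ k) \<le> 1 / (1 - w x y)"
      using lt by (simp add: sum_gp_strict divide_right_mono)
    then have "(\<Sum>k<N. w x y ^ k) / 4 \<le> 1 / (1 - w x y) / 4"
      by (rule divide_right_mono) simp
    then show ?thesis using d by (simp add: mult.commute)
  qed
  have diag: "w x x = 1" if "x \<in> S" for x
    using unit [OF that] by (simp add: w_def norm_eq_1)
  have "(real N)\<^sup>2 * harm N = (\<Sum>k<N. (real N)\<^sup>2 / (real k + 1))"
    by (simp add: harm_altdef sum_distrib_left divide_inverse add.commute)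
  also have "\<dots> \<le> (\<Sum>k<N. \<Sum>x\<in>S. \<Sum>y\<in>S. w x y ^ k)"
    unfolding N_def w_def by (intro sum_mono sum_half_inner_power_ge assms)
  also have "\<dots> = (\<Sum>x\<in>S. \<Sum>k<N. \<Sum>y\<in>S. w x y ^ k)"
    by (rule sum.swap)
  also have "\<dots> = (\<Sum>x\<in>S. \<Sum>y\<in>S. \<Sum>k<N. w x y ^ k)"
    by (intro sum.cong [OF refl], rule sum.swap)
  also have "\<dots> = (\<Sum>x\<in>S. real N + (\<Sum>y\<in>S - {x}. \<Sum>k<N. w x y ^ k))"
    using assms(1) by (intro sum.cong [OF refl]) (simp add: sum.remove diag)
  also have "\<dots> = (real N)\<^sup>2 + (\<Sum>x\<in>S. \<Sum>y\<in>S - {x}. \<Sum>k<N. w x y ^ k)"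
    by (simp add: sum.distrib N_def power2_eq_square)
  also have "\<dots> \<le> (real N)\<^sup>2 + (\<Sum>x\<in>S. \<Sum>y\<in>S - {x}. 4 * (1 / (norm (x - y))\<^sup>2))"
    using w by (intro add_left_mono sum_mono) fastforce
  also have "\<dots> = (real N)\<^sup>2 + 4 * riesz_2_energy S"
    using assms(1) by (simp add: riesz_2_energy_iterated_sum sum_distrib_left)
  finally show ?thesis by (simp add: algebra_simps)
qed

lemma min_riesz_2_energy_ge:
  assumes "N \<ge> 1"
  shows "(real N)\<^sup>2 / 4 * (ln (real N) - 1) \<le> min_riesz_2_energy N"
proof -
  obtain S where S: "S \<in> sphere_configs N" "riesz_2_energy S = min_riesz_2_energy N"
    using min_riesz_2_energy_attained by metis
  have "ln (real N) \<le> ln (real N + 1)" using assms by simp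
  also have "\<dots> \<le> harm N" by (rule ln_le_harm)
  finally have "(real N)\<^sup>2 / 4 * (ln (real N) - 1) \<le> (real N)\<^sup>2 / 4 * (harm N - 1)"
    by (intro mult_left_mono) auto
  also have "\<dots> \<le> riesz_2_energy S"
    using riesz_2_energy_lower_bound [of S] S(1) by (simp add: sphere_configs_def)
  finally show ?thesis using S(2) by simp
qed

section \<open>Averaging over the rotations of a parallel\<close>

text \<open>Up to a constant factor and a shift, the integrand is a Poisson kernel of the unit disc.\<close>

lemma has_integral_inverse_minus_cos:
  fixes A B \<alpha> :: real
  assumes A: "A > 0" "B\<^sup>2 < A\<^sup>2"
  shows "((\<lambda>t. 1 / (A - B * cos (t - \<alpha>))) has_integral 2 * pi / sqrt (A\<^sup>2 - B\<^sup>2)) {0..2 * pi}"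
proof -
  define D where "D = sqrt (A\<^sup>2 - B\<^sup>2)"
  define v where "v = A + D"
  have D: "D > 0" "D\<^sup>2 = A\<^sup>2 - B\<^sup>2" using A by (auto simp: D_def)
  have BA: "\<bar>B\<bar> < A" using A abs_le_square_iff [of A B] by linarith
  then have pos: "A - B * cos t > 0" for t
  proof -
    have "\<bar>B * cos t\<bar> \<le> \<bar>B\<bar>"
      using abs_cos_le_one [of t] by (simp add: abs_mult mult_left_le)
    with BA show ?thesis by linarith
  qed
  have pos': "v - B * cos t > 0" for t using pos [of t] D by (simp add: v_def)
  \<comment> \<open>With \<open>q = B / v\<close> this is \<open>t + 2 * arctan (q * sin t / (1 - q * cos t))\<close> shifted and scaled. Unlike the half-angle substitution it is smooth on the whole line.\<close>
  define F where "F t = (t + 2 * arctan (B * sin (t - \<alpha>) / (v - B * cos (t - \<alpha>)))) / D" for t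
  have deriv: "(F has_real_derivative 1 / (A - B * cos (t - \<alpha>))) (at t)" for t
  proof -
    let ?c = "cos (t - \<alpha>)" and ?s = "sin (t - \<alpha>)"
    define n where "n = B * ?s"
    define d where "d = v - B * ?c"
    have d: "d > 0" using pos' by (simp add: d_def)
    have q: "?s\<^sup>2 = 1 - ?c\<^sup>2" by (simp add: sin_squared_eq)
    have nd: "d\<^sup>2 + n\<^sup>2 = 2 * v * (A - B * ?c)"
    proof -
      have "d\<^sup>2 + n\<^sup>2 = v\<^sup>2 + B\<^sup>2 - 2 * v * B * ?c"
        unfolding d_def n_def power_mult_distrib q by (simp add: power2_eq_square algebra_simps)
      also have "v\<^sup>2 + B\<^sup>2 = 2 * v * A"
        using D(2) by (simp add: v_def power2_eq_square algebra_simps)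
      finally show ?thesis by (simp add: algebra_simps)
    qed
    have num: "1 + 2 * ((B * ?c * d - n * (B * ?s)) / (d\<^sup>2 + n\<^sup>2)) = D / (A - B * ?c)"
    proof -
      define p where "p = A - B * ?c"
      have p: "p > 0" using pos by (simp add: p_def)
      have v: "v > 0" using D A by (simp add: v_def)
      have "B * ?c * d - n * (B * ?s) = v * B * ?c - B\<^sup>2 * ?c\<^sup>2 - B\<^sup>2 * ?s\<^sup>2"
        by (simp add: d_def n_def power2_eq_square algebra_simps)
      also have "\<dots> = v * D - v * p"
        unfolding q using D(2) by (simp add: p_def v_def power2_eq_square algebra_simps)
      finally have e: "B * ?c * d - n * (B * ?s) = v * D - v * p" .
      show ?thesis
        unfolding e nd p_def [symmetric] using p v by (simp add: field_simps)
    qed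
    have "(F has_real_derivative
        (1 + 2 * (inverse (1 + (n / d)\<^sup>2) * ((B * ?c * d - n * (B * ?s)) / (d * d)))) / D) (at t)"
      unfolding F_def n_def d_def
      using pos' [of "t - \<alpha>"] D(1)
      by (auto intro!: derivative_eq_intros simp: field_simps)
    also have "inverse (1 + (n / d)\<^sup>2) * ((B * ?c * d - n * (B * ?s)) / (d * d))
      = (B * ?c * d - n * (B * ?s)) / (d\<^sup>2 + n\<^sup>2)"
    proof -
      have "1 + (n / d)\<^sup>2 = (d\<^sup>2 + n\<^sup>2) / (d * d)"
        using d by (simp add: field_simps power2_eq_square)
      then show ?thesis using d by (simp only:) simp
    qed
    finally show ?thesis unfolding num using D(1) by simp
  qed
  have "((\<lambda>t. 1 / (A - B * cos (t - \<alpha>))) has_integral F (2 * pi) - F 0) {0..2 * pi}"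
    by (rule fundamental_theorem_of_calculus)
       (auto simp flip: has_real_derivative_iff_has_vector_derivative
             intro!: has_field_derivative_at_within deriv)
  moreover have "F (2 * pi) - F 0 = 2 * pi / D"
  proof -
    have "sin (2 * pi - \<alpha>) = sin (0 - \<alpha>)" "cos (2 * pi - \<alpha>) = cos (0 - \<alpha>)"
      by (simp_all add: sin_diff cos_diff)
    then show ?thesis unfolding F_def by (simp add: diff_divide_distrib add_divide_distrib)
  qed
  ultimately show ?thesis by (simp add: D_def)
qed

definition sphere_point :: "real \<Rightarrow> real \<Rightarrow> real ^ 3" where
  "sphere_point z t = vector [sqrt (1 - z\<^sup>2) * cos t, sqrt (1 - z\<^sup>2) * sin t, z]"

lemma sphere_point_nth [simp]:
  "sphere_point z t $ 1 = sqrt (1 - z\<^sup>2) * cos t"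
  "sphere_point z t $ 2 = sqrt (1 - z\<^sup>2) * sin t"
  "sphere_point z t $ 3 = z"
  by (simp_all add: sphere_point_def)

lemma norm_sphere_point:
  assumes "\<bar>z\<bar> \<le> 1"
  shows "norm (sphere_point z t) = 1"
proof -
  have "z\<^sup>2 \<le> 1" using assms by (simp add: abs_square_le_1)
  then have "(sqrt (1 - z\<^sup>2))\<^sup>2 = 1 - z\<^sup>2" by simp
  then show ?thesis
    using sin_cos_squared_add [of t] unfolding norm_eq_1
    by (simp only: inner_vec_def sum_3 sphere_point_nth inner_real_def) algebra
qed

lemma sphere_point_surj:
  assumes "norm x = 1"
  obtains t where "x = sphere_point (x $ 3) t"
proof -
  have sq: "(x $ 1)\<^sup>2 + (x $ 2)\<^sup>2 + (x $ 3)\<^sup>2 = 1"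
    using assms by (simp add: norm_eq_1 inner_vec_def sum_3 power2_eq_square)
  \<comment> \<open>The azimuth is the argument of the horizontal part, which is arbitrary at the poles.\<close>
  obtain t where t: "Complex (x $ 1) (x $ 2) = rcis (cmod (Complex (x $ 1) (x $ 2))) t"
    using rcis_cmod_Arg by metis
  have "cmod (Complex (x $ 1) (x $ 2)) = sqrt (1 - (x $ 3)\<^sup>2)"
    using sq by (simp add: complex_norm eq_diff_eq)
  with t have "x $ 1 = sqrt (1 - (x $ 3)\<^sup>2) * cos t" "x $ 2 = sqrt (1 - (x $ 3)\<^sup>2) * sin t"
    by (simp_all add: complex_eq_iff)
  then have "x = sphere_point (x $ 3) t"
    by (simp add: vec_eq_iff forall_3)
  then show ?thesis using that by blast
qed

lemma dist_sphere_points: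
  assumes "\<bar>z\<bar> \<le> 1" "\<bar>z'\<bar> \<le> 1"
  shows "(norm (sphere_point z t - sphere_point z' t'))\<^sup>2
    = 2 - 2 * z * z' - 2 * sqrt (1 - z\<^sup>2) * sqrt (1 - z'\<^sup>2) * cos (t' - t)"
proof -
  have "(norm (sphere_point z t - sphere_point z' t'))\<^sup>2
    = 2 - 2 * (sphere_point z t \<bullet> sphere_point z' t')"
    using norm_sphere_point [OF assms(1), of t] norm_sphere_point [OF assms(2), of t']
    by (simp add: norm_eq_1 power2_norm_eq_inner inner_diff inner_commute)
  also have "\<dots> = 2 - 2 * z * z' - 2 * sqrt (1 - z\<^sup>2) * sqrt (1 - z'\<^sup>2) * cos (t' - t)"
    by (simp add: inner_vec_def sum_3 cos_diff algebra_simps)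
  finally show ?thesis .
qed

lemma has_integral_riesz_potential_on_parallel:
  assumes "norm x = 1" "\<bar>z\<bar> \<le> 1" "x $ 3 \<noteq> z"
  shows "((\<lambda>t. 1 / (norm (x - sphere_point z (t + \<beta>)))\<^sup>2) has_integral pi / \<bar>x $ 3 - z\<bar>) {0..2 * pi}"
proof -
  obtain \<alpha> where \<alpha>: "x = sphere_point (x $ 3) \<alpha>" using sphere_point_surj assms by metis
  define h where "h = x $ 3"
  have xh: "sphere_point h \<alpha> = x" using \<alpha> unfolding h_def by (rule sym)
  have h: "\<bar>h\<bar> \<le> 1" using component_le_norm_cart [of x 3] assms by (simp add: h_def)
  have hz: "h * z < 1"
  proof -
    have "(h - z)\<^sup>2 > 0" using assms by (simp add: h_def)
    moreover have "h\<^sup>2 \<le> 1" "z\<^sup>2 \<le> 1" using h assms by (simp_all add: abs_square_le_1)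
    ultimately show ?thesis by (simp add: power2_eq_square algebra_simps)
  qed
  define A where "A = 2 - 2 * h * z"
  define B where "B = 2 * sqrt (1 - h\<^sup>2) * sqrt (1 - z\<^sup>2)"
  have "h\<^sup>2 \<le> 1" "z\<^sup>2 \<le> 1" using h assms by (simp_all add: abs_square_le_1)
  then have "B\<^sup>2 = 4 * (1 - h\<^sup>2) * (1 - z\<^sup>2)" by (simp add: B_def power_mult_distrib)
  \<comment> \<open>The discriminant is a perfect square; this is why the average depends only on the height difference.\<close>
  then have AB: "A\<^sup>2 - B\<^sup>2 = (2 * (h - z))\<^sup>2"
    by (simp add: A_def power2_eq_square algebra_simps)
  then have lt: "B\<^sup>2 < A\<^sup>2" using assms by (simp add: h_def) (smt (verit) zero_less_power2)
  have "((\<lambda>t. 1 / (A - B * cos (t - (\<alpha> - \<beta>)))) has_integral 2 * pi / sqrt (A\<^sup>2 - B\<^sup>2)) {0..2 * pi}"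
    by (rule has_integral_inverse_minus_cos) (use lt hz in \<open>auto simp: A_def\<close>)
  moreover have "2 * pi / sqrt (A\<^sup>2 - B\<^sup>2) = pi / \<bar>x $ 3 - z\<bar>"
    unfolding AB real_sqrt_abs abs_mult by (simp add: h_def)
  moreover have "A - B * cos (t - (\<alpha> - \<beta>)) = (norm (x - sphere_point z (t + \<beta>)))\<^sup>2" for t
    using dist_sphere_points [OF h assms(2), of \<alpha> "t + \<beta>"] unfolding xh
    by (simp add: A_def B_def algebra_simps)
  ultimately show ?thesis by simp
qed

text \<open>A continuous function cannot exceed its mean everywhere. The offsets \<open>\<beta> k\<close> allow several points on the
parallel to be rotated rigidly together.\<close>

lemma exists_rotation_le_average:
  assumes S: "finite S" "S \<subseteq> sphere 0 1" "\<And>x. x \<in> S \<Longrightarrow> x $ 3 \<noteq> z" and z: "\<bar>z\<bar> \<le> 1"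
  obtains \<theta> where "(\<Sum>x\<in>S. \<Sum>k<r. 1 / (norm (x - sphere_point z (\<theta> + \<beta> k)))\<^sup>2)
    \<le> (\<Sum>x\<in>S. real r / (2 * \<bar>x $ 3 - z\<bar>))"
proof -
  define f where "f t = (\<Sum>x\<in>S. \<Sum>k<r. 1 / (norm (x - sphere_point z (t + \<beta> k)))\<^sup>2)" for t
  define c where "c = (\<Sum>x\<in>S. real r / (2 * \<bar>x $ 3 - z\<bar>))"
  have "(f has_integral (\<Sum>x\<in>S. \<Sum>k<r. pi / \<bar>x $ 3 - z\<bar>)) {0..2 * pi}"
    unfolding f_def using S z
    by (intro has_integral_sum has_integral_riesz_potential_on_parallel) auto
  also have "(\<Sum>x\<in>S. \<Sum>k<r. pi / \<bar>x $ 3 - z\<bar>) = 2 * pi * c"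
    by (simp add: c_def sum_distrib_left mult_ac)
  finally have int: "integral {0..2 * pi} f = 2 * pi * c"
    by (rule integral_unique)
  have nz: "norm (x - sphere_point z t) \<noteq> 0" if "x \<in> S" for x t
    using S(3) [OF that] by auto
  have sp: "continuous_on A (\<lambda>t. sphere_point z (t + b))" for A b
  proof -
    have "continuous_on A (\<lambda>t. sphere_point z (t + b) $ i)" for i
      using exhaust_3 [of i]
      by (elim disjE) (simp_all only: sphere_point_nth, (intro continuous_intros)+)
    then have "continuous_on A (\<lambda>t. \<chi> i. sphere_point z (t + b) $ i)"
      by (rule continuous_on_vec_lambda)
    then show ?thesis by simp
  qed
  have cont: "continuous_on {0..2 * pi} f"
    unfolding f_def by (intro continuous_intros sp) (use nz in auto)
  have "\<exists>\<theta>. f \<theta> \<le> c"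
  proof (rule ccontr)
    assume "\<not> ?thesis"
    then have "c < f \<theta>" for \<theta> by (simp add: not_le)
    moreover have "{0<..<2 * pi} \<noteq> {}"
      unfolding greaterThanLessThan_empty_iff using pi_gt_zero by linarith
    ultimately have "integral {0..2 * pi} (\<lambda>_. c) < integral {0..2 * pi} f"
      by (intro integral_less_real cont) auto
    then show False using int by simp
  qed
  then show ?thesis using that by (auto simp: f_def c_def)
qed

section \<open>Equally spaced points on a parallel\<close>

lemma parseval_roots_of_unity:
  fixes c :: "nat \<Rightarrow> complex" and n :: nat
  defines "u \<equiv> (\<lambda>k. cis (2 * pi * real k / real n))"
  assumes n: "n > 0"
  shows "(\<Sum>l<n. (cmod (\<Sum>j<n. c j * u l ^ j))\<^sup>2) = real n * (\<Sum>j<n. (cmod (c j))\<^sup>2)"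
proof -
  have bij: "bij_betw u {..<n} {z. z ^ n = 1}"
    unfolding u_def using Complex.bij_betw_roots_unity [OF n] .
  have root: "u l ^ n = 1" if "l < n" for l
    using bij_betwE [OF bij] that by auto
  have u_power: "u l ^ j = u j ^ l" for l j
    unfolding u_def Complex.DeMoivre by (simp add: mult_ac)
  have unit: "u j * cnj (u j) = 1" for j
    using complex_norm_square [of "u j"] by (simp add: u_def)
  \<comment> \<open>Orthogonality of the characters of the cyclic group.\<close>
  have orth: "(\<Sum>l<n. u l ^ j * cnj (u l ^ i)) = (if i = j then of_nat n else 0)"
    if "i < n" "j < n" for i j
  proof -
    define q where "q = u j * cnj (u i)"
    have "u l ^ j * cnj (u l ^ i) = q ^ l" for l
      unfolding u_power [of l] by (simp add: q_def power_mult_distrib)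
    then have eq: "(\<Sum>l<n. u l ^ j * cnj (u l ^ i)) = (\<Sum>l<n. q ^ l)" by simp
    show ?thesis
    proof (cases "i = j")
      case True
      then show ?thesis using eq unit by (simp add: q_def)
    next
      case False
      have "q * u i = u j" using unit [of i] by (simp add: q_def mult_ac)
      then have "q \<noteq> 1"
        using bij that False by (auto simp: bij_betw_def inj_on_def)
      moreover have "q ^ n = 1"
        using root that by (simp add: q_def power_mult_distrib flip: complex_cnj_power)
      ultimately show ?thesis unfolding eq using False by (simp add: geometric_sum)
    qed
  qed
  have "complex_of_real (\<Sum>l<n. (cmod (\<Sum>j<n. c j * u l ^ j))\<^sup>2)
    = (\<Sum>l<n. \<Sum>j<n. \<Sum>i<n. c j * cnj (c i) * (u l ^ j * cnj (u l ^ i)))"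
    by (simp only: of_real_sum complex_norm_square cnj_sum complex_cnj_mult sum_product mult_ac)
  also have "\<dots> = (\<Sum>j<n. \<Sum>i<n. \<Sum>l<n. c j * cnj (c i) * (u l ^ j * cnj (u l ^ i)))"
    by (rule trans [OF sum.swap]) (rule sum.cong [OF refl], rule sum.swap)
  also have "\<dots> = (\<Sum>j<n. \<Sum>i<n. c j * cnj (c i) * (if i = j then of_nat n else 0))"
    by (intro sum.cong [OF refl]) (simp only: sum_distrib_left [symmetric] orth lessThan_iff)
  also have "\<dots> = (\<Sum>j<n. c j * cnj (c j) * of_nat n)"
    by (intro sum.cong [OF refl]) (simp add: if_distrib sum.delta cong: if_cong)
  also have "\<dots> = complex_of_real (real n * (\<Sum>j<n. (cmod (c j))\<^sup>2))"
    by (simp only: of_real_mult of_real_sum complex_norm_square sum_distrib_left of_real_of_nat_eq mult_ac)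
  finally show ?thesis by (simp only: of_real_eq_iff)
qed

text \<open>This Fourier coefficient makes Parseval's identity for the sequence \<open>0, 1, \<dots>, n - 1\<close> a statement about
the inverse squared distances between roots of unity.\<close>

lemma sum_index_power_root_of_unity:
  fixes q :: "'a :: field"
  assumes "q ^ n = 1" "q \<noteq> 1"
  shows "(\<Sum>j<n. of_nat j * q ^ j) = of_nat n / (q - 1)"
proof -
  have "(q - 1) * (\<Sum>j<n. of_nat j * q ^ j) = of_nat n * q ^ n - q * (\<Sum>j<n. q ^ j)"
    by (induction n) (simp_all add: algebra_simps)
  also have "\<dots> = of_nat n"
    using assms by (simp add: geometric_sum)
  finally show ?thesis using assms(2) by (simp add: field_simps)
qed

text \<open>Parseval for \<open>j \<mapsto> j * cnj (u k) ^ j\<close>: the transform has squared modulus \<open>n\<^sup>2 / (cmod (u l - u k))\<^sup>2\<close> for \<open>l \<noteq> k\<close>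
and \<open>(n * (n - 1) / 2)\<^sup>2\<close> for \<open>l = k\<close>, so the sum is \<open>(n - 1) * (2 * n - 1) / 6 - (n - 1)\<^sup>2 / 4\<close>.\<close>

lemma sum_inverse_dist_roots_of_unity:
  defines "u \<equiv> (\<lambda>n k. cis (2 * pi * real k / real n))"
  assumes k: "k < n"
  shows "(\<Sum>l\<in>{..<n} - {k}. 1 / (cmod (u n l - u n k))\<^sup>2) = ((real n)\<^sup>2 - 1) / 12"
proof -
  have n: "n > 0" using k by simp
  have bij: "bij_betw (u n) {..<n} {z. z ^ n = 1}"
    unfolding u_def using Complex.bij_betw_roots_unity [OF n] .
  have unit: "u n l * cnj (u n l) = 1" for l
    using complex_norm_square [of "u n l"] by (simp add: u_def)
  have root: "u n l ^ n = 1" if "l < n" for l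
    using bij_betwE [OF bij] that by auto
  define s where "s l = (\<Sum>j<n. of_nat j * cnj (u n k ^ j) * u n l ^ j)" for l
  have s: "(cmod (s l))\<^sup>2 = (real n)\<^sup>2 * (1 / (cmod (u n l - u n k))\<^sup>2)" if l: "l < n" "l \<noteq> k" for l
  proof -
    define q where "q = u n l * cnj (u n k)"
    have uq: "q * u n k = u n l" using unit [of k] by (simp add: q_def mult_ac)
    then have "q \<noteq> 1" using bij l k by (auto simp: bij_betw_def inj_on_def)
    moreover have "q ^ n = 1"
      using root l k by (simp add: q_def power_mult_distrib flip: complex_cnj_power)
    ultimately have "s l = of_nat n / (q - 1)"
      using sum_index_power_root_of_unity [of q n] by (simp add: s_def q_def power_mult_distrib mult_ac)
    moreover have "cmod (q - 1) = cmod (u n l - u n k)"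
    proof -
      have "u n l - u n k = (q - 1) * u n k" using uq by (simp add: algebra_simps)
      then show ?thesis by (simp add: norm_mult u_def)
    qed
    ultimately show ?thesis by (simp add: norm_divide power_divide)
  qed
  have sk: "s k = of_nat (\<Sum>j<n. j)"
  proof -
    have "cnj (u n k ^ j) * u n k ^ j = 1" for j
      using unit [of k] by (simp add: mult.commute flip: power_mult_distrib)
    then show ?thesis by (simp add: s_def mult.assoc)
  qed
  have total: "(\<Sum>l<n. (cmod (s l))\<^sup>2) = real n * (\<Sum>j<n. (real j)\<^sup>2)"
    using parseval_roots_of_unity [OF n, of "\<lambda>j. of_nat j * cnj (u n k ^ j)"]
    by (simp add: s_def u_def norm_mult norm_power)
  have split: "(\<Sum>l<n. (cmod (s l))\<^sup>2)
    = (cmod (s k))\<^sup>2 + (\<Sum>l\<in>{..<n} - {k}. (cmod (s l))\<^sup>2)"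
    using k by (simp add: sum.remove)
  have rest: "(\<Sum>l\<in>{..<n} - {k}. (cmod (s l))\<^sup>2)
    = (real n)\<^sup>2 * (\<Sum>l\<in>{..<n} - {k}. 1 / (cmod (u n l - u n k))\<^sup>2)"
    using s by (simp add: sum_distrib_left)
  have diag: "cmod (s k) = real n * (real n - 1) / 2"
  proof -
    have "real (\<Sum>j<n. j) = real n * (real n - 1) / 2"
      by (induction n) (simp_all add: field_simps)
    then show ?thesis unfolding sk by (simp only: norm_of_nat)
  qed
  have squares: "(\<Sum>j<n. (real j)\<^sup>2) = real n * (real n - 1) * (2 * real n - 1) / 6"
    by (induction n) (simp_all add: field_simps power2_eq_square)
  have "(real n)\<^sup>2 * (\<Sum>l\<in>{..<n} - {k}. 1 / (cmod (u n l - u n k))\<^sup>2)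
    = real n * (\<Sum>j<n. (real j)\<^sup>2) - (cmod (s k))\<^sup>2"
    using total split rest by linarith
  also have "\<dots> = (real n)\<^sup>2 * (((real n)\<^sup>2 - 1) / 12)"
    unfolding squares diag by (simp add: power2_eq_square field_simps)
  finally show ?thesis using n by simp
qed

lemma dist_on_parallel:
  assumes "\<bar>z\<bar> \<le> 1"
  shows "(norm (sphere_point z s - sphere_point z t))\<^sup>2 = (1 - z\<^sup>2) * (cmod (cis s - cis t))\<^sup>2"
proof -
  have "z\<^sup>2 \<le> 1" using assms by (simp add: abs_square_le_1)
  then have "2 * sqrt (1 - z\<^sup>2) * sqrt (1 - z\<^sup>2) * cos (t - s) = 2 * (1 - z\<^sup>2) * cos (t - s)"
    by (simp add: mult.assoc)
  moreover have "(cmod (cis s - cis t))\<^sup>2 = 2 - 2 * cos (t - s)"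
    using sin_cos_squared_add [of s] sin_cos_squared_add [of t]
    unfolding cmod_power2 by (simp add: cos_diff power2_eq_square algebra_simps)
  ultimately show ?thesis
    by (simp only: dist_sphere_points [OF assms assms]) (simp add: power2_eq_square algebra_simps)
qed

definition ring_point :: "real \<Rightarrow> nat \<Rightarrow> real \<Rightarrow> nat \<Rightarrow> real ^ 3" where
  "ring_point z r \<theta> k = sphere_point z (\<theta> + 2 * pi * real k / real r)"

lemma dist_ring_points:
  assumes "\<bar>z\<bar> \<le> 1"
  shows "(norm (ring_point z r \<theta> k - ring_point z r \<theta> l))\<^sup>2
    = (1 - z\<^sup>2) * (cmod (cis (2 * pi * real k / real r) - cis (2 * pi * real l / real r)))\<^sup>2"
proof -
  have "cis (\<theta> + a) - cis (\<theta> + b) = cis \<theta> * (cis a - cis b)" for a b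
    by (simp add: cis_mult algebra_simps)
  then show ?thesis
    unfolding ring_point_def dist_on_parallel [OF assms] by (simp add: norm_mult)
qed

lemma inj_on_ring_point:
  assumes "\<bar>z\<bar> < 1 \<or> (\<bar>z\<bar> = 1 \<and> r = 1)"
  shows "inj_on (ring_point z r \<theta>) {..<r}"
proof (rule inj_onI)
  fix k l assume kl: "k \<in> {..<r}" "l \<in> {..<r}" "ring_point z r \<theta> k = ring_point z r \<theta> l"
  show "k = l"
  proof (cases "\<bar>z\<bar> < 1")
    case True
    then have "1 - z\<^sup>2 \<noteq> 0" by (simp add: abs_square_eq_1)
    with kl dist_ring_points [of z r \<theta> k l] True
    have "cis (2 * pi * real k / real r) = cis (2 * pi * real l / real r)" by simp
    moreover have "inj_on (\<lambda>k. cis (2 * pi * real k / real r)) {..<r}"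
      using Complex.bij_betw_roots_unity [of r] kl by (auto simp: bij_betw_def)
    ultimately show ?thesis using kl by (auto simp: inj_on_def)
  next
    case False
    then show ?thesis using assms kl by auto
  qed
qed

lemma riesz_2_energy_ring:
  assumes "\<bar>z\<bar> < 1 \<or> (\<bar>z\<bar> = 1 \<and> r = 1)"
  shows "riesz_2_energy (ring_point z r \<theta> ` {..<r}) = real r * ((real r)\<^sup>2 - 1) / (12 * (1 - z\<^sup>2))"
proof -
  let ?u = "\<lambda>k. cis (2 * pi * real k / real r)"
  have z: "\<bar>z\<bar> \<le> 1" using assms by auto
  have "riesz_2_energy (ring_point z r \<theta> ` {..<r})
    = (\<Sum>(i, j) \<in> {(i, j). i < r \<and> j < r \<and> i \<noteq> j}. 1 / (norm (ring_point z r \<theta> i - ring_point z r \<theta> j))\<^sup>2)"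
    by (rule riesz_2_energy_image) (rule inj_on_ring_point [OF assms])
  also have "{(i, j). i < r \<and> j < r \<and> i \<noteq> j} = Sigma {..<r} (\<lambda>i. {..<r} - {i})" by auto
  also have "(\<Sum>(i, j) \<in> Sigma {..<r} (\<lambda>i. {..<r} - {i}). 1 / (norm (ring_point z r \<theta> i - ring_point z r \<theta> j))\<^sup>2)
    = (\<Sum>i<r. \<Sum>j\<in>{..<r} - {i}. 1 / (norm (ring_point z r \<theta> i - ring_point z r \<theta> j))\<^sup>2)"
    by (simp add: sum.Sigma)
  also have "\<dots> = (\<Sum>i<r. \<Sum>j\<in>{..<r} - {i}. 1 / (cmod (?u j - ?u i))\<^sup>2 / (1 - z\<^sup>2))"
    by (intro sum.cong [OF refl], subst dist_ring_points [OF z], subst norm_minus_commute) simp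
  also have "\<dots> = (\<Sum>i<r. ((real r)\<^sup>2 - 1) / 12 / (1 - z\<^sup>2))"
    by (intro sum.cong [OF refl], subst sum_divide_distrib [symmetric])
       (simp only: sum_inverse_dist_roots_of_unity lessThan_iff)
  finally show ?thesis by simp
qed

section \<open>Rings on distinct parallels, rotated independently\<close>

lemma riesz_2_energy_Un:
  assumes "finite S" "finite T" "S \<inter> T = {}"
  shows "riesz_2_energy (S \<union> T)
    = riesz_2_energy S + riesz_2_energy T + 2 * (\<Sum>x\<in>S. \<Sum>y\<in>T. 1 / (norm (x - y))\<^sup>2)"
proof -
  let ?f = "\<lambda>x y. 1 / (norm (x - y :: real ^ 3))\<^sup>2"
  have "(\<Sum>y\<in>S \<union> T - {x}. ?f x y) = (\<Sum>y\<in>S - {x}. ?f x y) + (\<Sum>y\<in>T. ?f x y)" if "x \<in> S" for x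
  proof -
    have "S \<union> T - {x} = (S - {x}) \<union> T" using assms that by auto
    then show ?thesis using assms by (simp add: sum.union_disjoint Diff_Int_distrib2)
  qed
  moreover have "(\<Sum>y\<in>S \<union> T - {x}. ?f x y) = (\<Sum>y\<in>T - {x}. ?f x y) + (\<Sum>y\<in>S. ?f y x)" if "x \<in> T" for x
  proof -
    have "S \<union> T - {x} = (T - {x}) \<union> S" using assms that by auto
    moreover have "(T - {x}) \<inter> S = {}" using assms by auto
    ultimately show ?thesis using assms by (simp add: sum.union_disjoint norm_minus_commute)
  qed
  moreover have "(\<Sum>x\<in>T. \<Sum>y\<in>S. ?f y x) = (\<Sum>x\<in>S. \<Sum>y\<in>T. ?f x y)"
    by (rule sum.swap)
  ultimately show ?thesis
    using assms by (simp add: riesz_2_energy_iterated_sum sum.union_disjoint sum.distrib)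
qed

text \<open>A ring \<open>(z, r)\<close> stands for \<open>r\<close> equally spaced points at height \<open>z\<close>. The value is the energy averaged over
independent rotations of the rings; the factor \<open>1 / 2\<close> of the averaged potential cancels against the two
orders of a pair of points.\<close>

fun ring_energy :: "(real \<times> nat) list \<Rightarrow> real" where
  "ring_energy [] = 0"
| "ring_energy ((z, r) # R) = real r * ((real r)\<^sup>2 - 1) / (12 * (1 - z\<^sup>2))
    + (\<Sum>(z', r')\<leftarrow>R. real r' * real r / \<bar>z' - z\<bar>) + ring_energy R"

text \<open>A ring at a pole can hold only one point; its self-energy is then \<open>0 / 0 = 0\<close>, as it should be.\<close>

definition admissible_rings :: "(real \<times> nat) list \<Rightarrow> bool" where
  "admissible_rings R \<longleftrightarrow> distinct (map fst R)
    \<and> (\<forall>(z, r)\<in>set R. \<bar>z\<bar> < 1 \<or> (\<bar>z\<bar> = 1 \<and> r = 1))"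

text \<open>The rings are added one at a time, each rotated no worse than average against the points already placed. Only
the heights of these points enter the average, so the induction carries along how many of them lie at
which height, in the form of sums of arbitrary functions of the height.\<close>

theorem rotated_rings:
  assumes "admissible_rings R"
  shows "\<exists>S \<in> sphere_configs (sum_list (map snd R)). riesz_2_energy S \<le> ring_energy R
    \<and> (\<lambda>x. x $ 3) ` S \<subseteq> fst ` set R
    \<and> (\<forall>g :: real \<Rightarrow> real. (\<Sum>x\<in>S. g (x $ 3)) = (\<Sum>(z, r)\<leftarrow>R. real r * g z))"
  using assms
proof (induction R)
  case Nil
  then show ?case by (auto simp: sphere_configs_def riesz_2_energy_def)
next
  case (Cons a R)
  obtain z r where a: "a = (z, r)" by (cases a)
  have z: "\<bar>z\<bar> < 1 \<or> (\<bar>z\<bar> = 1 \<and> r = 1)" and z1: "\<bar>z\<bar> \<le> 1" and notin: "z \<notin> fst ` set R"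
    and adm: "admissible_rings R"
    using Cons.prems by (auto simp: a admissible_rings_def)
  obtain S where S: "S \<in> sphere_configs (sum_list (map snd R))" "riesz_2_energy S \<le> ring_energy R"
    "(\<lambda>x. x $ 3) ` S \<subseteq> fst ` set R"
    "\<And>g :: real \<Rightarrow> real. (\<Sum>x\<in>S. g (x $ 3)) = (\<Sum>(z, r)\<leftarrow>R. real r * g z)"
    using Cons.IH [OF adm] by blast
  have fin: "finite S" and sub: "S \<subseteq> sphere 0 1" and card: "card S = sum_list (map snd R)"
    using S(1) by (auto simp: sphere_configs_def)
  have ne: "x $ 3 \<noteq> z" if "x \<in> S" for x using S(3) notin that by auto
  obtain \<theta> where \<theta>: "(\<Sum>x\<in>S. \<Sum>k<r. 1 / (norm (x - ring_point z r \<theta> k))\<^sup>2)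
      \<le> (\<Sum>x\<in>S. real r / (2 * \<bar>x $ 3 - z\<bar>))"
    using exists_rotation_le_average [OF fin sub ne z1, where \<beta> = "\<lambda>k. 2 * pi * real k / real r"]
    unfolding ring_point_def by metis
  define T where "T = ring_point z r \<theta> ` {..<r}"
  have inj: "inj_on (ring_point z r \<theta>) {..<r}" by (rule inj_on_ring_point [OF z])
  have T3: "y $ 3 = z" if "y \<in> T" for y using that by (auto simp: T_def ring_point_def)
  have T: "finite T" "T \<subseteq> sphere 0 1" "card T = r" "S \<inter> T = {}"
    using ne T3 z1 card_image [OF inj] by (auto simp: T_def ring_point_def norm_sphere_point)
  have "(\<Sum>x\<in>S. \<Sum>y\<in>T. 1 / (norm (x - y))\<^sup>2) \<le> (\<Sum>x\<in>S. real r / (2 * \<bar>x $ 3 - z\<bar>))"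
    using \<theta> by (simp add: T_def sum.reindex [OF inj])
  also have "\<dots> = (\<Sum>(z', r')\<leftarrow>R. real r' * (real r / (2 * \<bar>z' - z\<bar>)))"
    by (rule S(4))
  also have "\<dots> = (\<Sum>(z', r')\<leftarrow>R. real r' * real r / \<bar>z' - z\<bar>) / 2"
    by (induction R) (auto simp: add_divide_distrib)
  finally have "riesz_2_energy (S \<union> T) \<le> ring_energy (a # R)"
    using S(2) fin T
    by (simp add: riesz_2_energy_Un a T_def riesz_2_energy_ring [OF z])
  moreover have "S \<union> T \<in> sphere_configs (sum_list (map snd (a # R)))"
    using fin sub card T by (auto simp: sphere_configs_def a card_Un_disjoint)
  moreover have "(\<lambda>x. x $ 3) ` (S \<union> T) \<subseteq> fst ` set (a # R)"
    using S(3) T3 by (auto simp: a)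
  moreover have "(\<Sum>x\<in>S \<union> T. g (x $ 3)) = (\<Sum>(z, r)\<leftarrow>a # R. real r * g z)" for g :: "real \<Rightarrow> real"
  proof -
    have "(\<Sum>x\<in>T. g (x $ 3)) = (\<Sum>x\<in>T. g z)" using T3 by (intro sum.cong) auto
    then show ?thesis using fin T S(4) [of g] by (simp add: sum.union_disjoint a)
  qed
  ultimately show ?case by blast
qed

lemma riesz_2_energy_nonneg: "riesz_2_energy S \<ge> 0"
  unfolding riesz_2_energy_def by (rule sum_nonneg) auto

lemma min_riesz_2_energy_le:
  assumes "S \<in> sphere_configs N"
  shows "min_riesz_2_energy N \<le> riesz_2_energy S"
  unfolding min_riesz_2_energy_def
  by (rule cINF_lower [OF _ assms]) (auto intro!: bdd_belowI2 riesz_2_energy_nonneg)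

corollary min_riesz_2_energy_le_ring_energy:
  assumes "admissible_rings R"
  shows "min_riesz_2_energy (sum_list (map snd R)) \<le> ring_energy R"
  using rotated_rings [OF assms] min_riesz_2_energy_le order_trans by blast

text \<open>The energy of rings at the heights \<open>1 - u / K\<close>. In these coordinates every family used below has integer
positions \<open>u\<close> between \<open>0\<close> and \<open>2 * K\<close>, and the energy becomes a plain sum of fractions.\<close>

fun scaled_ring_energy :: "real \<Rightarrow> (real \<times> nat) list \<Rightarrow> real" where
  "scaled_ring_energy K [] = 0"
| "scaled_ring_energy K ((u, r) # L) = K\<^sup>2 * (real r * ((real r)\<^sup>2 - 1) / (12 * (u * (2 * K - u))))
    + K * (\<Sum>(v, s)\<leftarrow>L. real r * real s / \<bar>u - v\<bar>) + scaled_ring_energy K L"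

definition rings_at :: "real \<Rightarrow> (real \<times> nat) list \<Rightarrow> (real \<times> nat) list" where
  "rings_at K L = map (\<lambda>(u, r). (1 - u / K, r)) L"

lemma ring_energy_rings_at:
  assumes "K > 0"
  shows "ring_energy (rings_at K L) = scaled_ring_energy K L"
proof (induction L)
  case (Cons a L)
  obtain u r where a: "a = (u, r)" by (cases a)
  have "1 - (1 - u / K)\<^sup>2 = u * (2 * K - u) / K\<^sup>2"
    using assms by (simp add: field_simps power2_eq_square)
  then have self: "real r * ((real r)\<^sup>2 - 1) / (12 * (1 - (1 - u / K)\<^sup>2))
    = K\<^sup>2 * (real r * ((real r)\<^sup>2 - 1) / (12 * (u * (2 * K - u))))"
    by simp
  have dist: "\<bar>u / K - v / K\<bar> = \<bar>u - v\<bar> / K" for v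
    using assms by (simp flip: diff_divide_distrib)
  have "(\<Sum>(z', r')\<leftarrow>rings_at K L. real r' * real r / \<bar>z' - (1 - u / K)\<bar>)
    = K * (\<Sum>(v, s)\<leftarrow>L. real r * real s / \<bar>u - v\<bar>)"
    unfolding rings_at_def
    by (induction L) (auto simp: dist distrib_left mult_ac)
  with self Cons.IH show ?case
    by (simp add: a rings_at_def)
qed (simp add: rings_at_def)

text \<open>Energy is additive up to the interaction of the two groups of rings.\<close>

lemma scaled_ring_energy_append:
  "scaled_ring_energy K (L @ L') = scaled_ring_energy K L + scaled_ring_energy K L'
    + K * (\<Sum>(u, r)\<leftarrow>L. \<Sum>(v, s)\<leftarrow>L'. real r * real s / \<bar>u - v\<bar>)"
  by (induction L) (auto simp: algebra_simps)

lemma scaled_ring_energy_reflect: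
  "scaled_ring_energy K (map (\<lambda>(u, r). (2 * K - u, r)) L) = scaled_ring_energy K L"
proof (induction L)
  case (Cons a L)
  obtain u r where a: "a = (u, r)" by (cases a)
  have "(\<Sum>(v, s)\<leftarrow>map (\<lambda>(u, r). (2 * K - u, r)) L. real r * real s / \<bar>2 * K - u - v\<bar>)
    = (\<Sum>(v, s)\<leftarrow>L. real r * real s / \<bar>u - v\<bar>)"
    by (induction L) (auto simp: abs_minus_commute)
  then show ?case using Cons.IH by (simp add: a mult_ac)
qed simp

lemma min_riesz_2_energy_le_scaled:
  assumes "K > 0" "distinct (map fst L)" "\<forall>(u, r)\<in>set L. (0 < u \<and> u < 2 * K) \<or> ((u = 0 \<or> u = 2 * K) \<and> r = 1)"
    and "sum_list (map snd L) = N"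
  shows "min_riesz_2_energy N \<le> scaled_ring_energy K L"
proof -
  have "admissible_rings (rings_at K L)"
    unfolding admissible_rings_def
  proof
    have "inj (\<lambda>u. 1 - u / K)" using assms(1) by (auto intro!: injI)
    then have "distinct (map (\<lambda>u. 1 - u / K) (map fst L))"
      using assms(2) by (subst distinct_map) (auto intro: inj_on_subset)
    then show "distinct (map fst (rings_at K L))"
      by (simp add: rings_at_def comp_def case_prod_unfold)
    have "\<bar>1 - u / K\<bar> < 1 \<or> (\<bar>1 - u / K\<bar> = 1 \<and> r = 1)" if ur: "(u, r) \<in> set L" for u r
    proof -
      consider "0 < u" "u < 2 * K" | "u = 0 \<or> u = 2 * K" "r = 1"
        using bspec [OF assms(3) ur] by auto
      then show ?thesis
      proof cases
        case 1
        then have "0 < u / K" "u / K < 2"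
          using assms(1) by (simp_all add: pos_divide_less_eq)
        then show ?thesis by linarith
      qed (use assms(1) in auto)
    qed
    then show "\<forall>(z, r)\<in>set (rings_at K L). \<bar>z\<bar> < 1 \<or> (\<bar>z\<bar> = 1 \<and> r = 1)"
      by (auto simp: rings_at_def)
  qed
  moreover have "sum_list (map snd (rings_at K L)) = N"
    using assms(4) by (simp add: rings_at_def comp_def case_prod_unfold)
  ultimately show ?thesis
    using min_riesz_2_energy_le_ring_energy [of "rings_at K L"] ring_energy_rings_at [OF assms(1)] by simp
qed

section \<open>Removing points from a configuration\<close>

text \<open>Deleting the points of a minimal configuration one at a time, every pair survives in all but two of the \<open>N + 1\<close>
configurations obtained.\<close>

lemma min_riesz_2_energy_Suc:
  assumes "N \<ge> 1"
  shows "real (N + 1) * min_riesz_2_energy N \<le> (real N - 1) * min_riesz_2_energy (N + 1)"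
proof -
  obtain S where S: "S \<in> sphere_configs (N + 1)" "riesz_2_energy S = min_riesz_2_energy (N + 1)"
    using min_riesz_2_energy_attained by metis
  have fin: "finite S" and card: "card S = N + 1" using S(1) by (auto simp: sphere_configs_def)
  let ?f = "\<lambda>x y. 1 / (norm (x - y :: real ^ 3))\<^sup>2"
  \<comment> \<open>The factor 2 counts both orders of the pairs that contain \<open>p\<close>.\<close>
  have removal: "riesz_2_energy (S - {p}) = riesz_2_energy S - 2 * (\<Sum>y\<in>S - {p}. ?f p y)"
    if "p \<in> S" for p
  proof -
    have "riesz_2_energy ({p} \<union> (S - {p}))
      = riesz_2_energy {p} + riesz_2_energy (S - {p}) + 2 * (\<Sum>x\<in>{p}. \<Sum>y\<in>S - {p}. ?f x y)"
      using fin by (intro riesz_2_energy_Un) auto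
    moreover have "{p} \<union> (S - {p}) = S" using that by auto
    moreover have "riesz_2_energy {p} = 0" by (simp add: riesz_2_energy_iterated_sum)
    ultimately show ?thesis by simp
  qed
  have "real (N + 1) * min_riesz_2_energy N = (\<Sum>p\<in>S. min_riesz_2_energy N)"
    using card by simp
  also have "\<dots> \<le> (\<Sum>p\<in>S. riesz_2_energy (S - {p}))"
    by (intro sum_mono min_riesz_2_energy_le) (use S(1) in \<open>auto simp: sphere_configs_def\<close>)
  also have "\<dots> = (\<Sum>p\<in>S. riesz_2_energy S - 2 * (\<Sum>y\<in>S - {p}. ?f p y))"
    by (intro sum.cong [OF refl] removal)
  also have "\<dots> = real (N + 1) * riesz_2_energy S - 2 * riesz_2_energy S"
    using fin card by (simp add: sum_subtractf sum_distrib_left [symmetric] riesz_2_energy_iterated_sum [OF fin, symmetric])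
  finally show ?thesis by (simp add: S(2) algebra_simps)
qed

lemma min_riesz_2_energy_scaled_mono:
  assumes "2 \<le> N" "N \<le> M"
  shows "min_riesz_2_energy N \<le> real N * (real N - 1) * (min_riesz_2_energy M / (real M * (real M - 1)))"
  using assms(2)
proof (induction M rule: dec_induct)
  case base
  then show ?case using assms(1) by simp
next
  case (step M)
  have M: "real M \<ge> 2" using step assms by simp
  have "min_riesz_2_energy M \<le> (real M - 1) * min_riesz_2_energy (M + 1) / (real M + 1)"
    using min_riesz_2_energy_Suc [of M] M by (simp add: field_simps)
  then have "min_riesz_2_energy M / (real M * (real M - 1))
    \<le> (real M - 1) * min_riesz_2_energy (M + 1) / (real M + 1) / (real M * (real M - 1))"
    using M by (intro divide_right_mono) auto
  also have "\<dots> = min_riesz_2_energy (Suc M) / (real (Suc M) * (real (Suc M) - 1))"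
    using M by (simp add: divide_simps)
  finally have "real N * (real N - 1) * (min_riesz_2_energy M / (real M * (real M - 1)))
    \<le> real N * (real N - 1) * (min_riesz_2_energy (Suc M) / (real (Suc M) * (real (Suc M) - 1)))"
    using assms(1) by (intro mult_left_mono) auto
  with step.IH show ?case by linarith
qed

section \<open>The octahedral rings\<close>

definition cap :: "nat \<Rightarrow> (real \<times> nat) list" where
  "cap n = map (\<lambda>j. ((real j)\<^sup>2, 4 * j)) [1..<n]"

text \<open>The numbers of points are those of the levels of an octahedron whose edges are divided into \<open>m\<close> parts, the two
poles left out. In the scale \<open>K = m\<^sup>2\<close> the band between the positions \<open>j * (j - 1)\<close> and \<open>j * (j + 1)\<close> has area
proportional to \<open>j\<close>, and \<open>j\<^sup>2\<close> is its middle.\<close>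

definition octahedral_rings :: "nat \<Rightarrow> (real \<times> nat) list" where
  "octahedral_rings m = cap m @ ((real m)\<^sup>2, 4 * m)
    # map (\<lambda>(u, r). (2 * (real m)\<^sup>2 - u, r)) (cap m)"

lemma sum_list_cap: "(\<Sum>(u, r)\<leftarrow>cap n. f u r) = (\<Sum>j=1..<n. f ((real j)\<^sup>2) (4 * j))"
  by (simp add: cap_def comp_def interv_sum_list_conv_sum_set_nat)

lemma card_octahedral_rings:
  assumes "m \<ge> 1"
  shows "sum_list (map snd (octahedral_rings m)) = 4 * m\<^sup>2"
proof -
  have "(\<Sum>j=1..<Suc n. 4 * j) = 2 * n * (n + 1)" for n :: nat
    by (induction n) auto
  moreover have "sum_list (map snd (cap m)) = (\<Sum>j=1..<m. 4 * j)"
    using sum_list_cap [of "\<lambda>u r. r" m] by (simp add: case_prod_unfold)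
  ultimately show ?thesis
    using assms by (cases m) (simp_all add: octahedral_rings_def comp_def case_prod_unfold power2_eq_square)
qed

lemma octahedral_rings_heights:
  assumes "m \<ge> 1"
  shows "distinct (map fst (octahedral_rings m))"
    and "\<forall>(u, r)\<in>set (octahedral_rings m). 0 < u \<and> u < 2 * (real m)\<^sup>2"
proof -
  let ?K = "(real m)\<^sup>2"
  have K: "?K > 0" using assms by simp
  have lt: "(real j)\<^sup>2 < ?K" if "j < m" for j
    using that by (simp add: power_strict_mono)
  have inj: "inj_on (\<lambda>j. (real j)\<^sup>2) A" for A
    by (auto intro!: inj_onI)
  have "map fst (octahedral_rings m) = map (\<lambda>j. (real j)\<^sup>2) [1..<m] @ ?K
    # map (\<lambda>j. 2 * ?K - (real j)\<^sup>2) [1..<m]"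
    by (simp add: octahedral_rings_def cap_def comp_def case_prod_unfold)
  moreover have "(real i)\<^sup>2 \<noteq> 2 * ?K - (real j)\<^sup>2" if "i < m" "j < m" for i j
    using lt [OF that(1)] lt [OF that(2)] by linarith
  ultimately show "distinct (map fst (octahedral_rings m))"
    using inj lt by (auto simp: distinct_map inj_on_def)
  have range: "0 < u \<and> u < ?K" if "(u, r) \<in> set (cap m)" for u r
    using that by (auto simp: cap_def power_strict_mono)
  have "0 < u \<and> u < 2 * ?K" if "(u, r) \<in> set (octahedral_rings m)" for u r
    using that K by (auto simp: octahedral_rings_def dest: range)
  then show "\<forall>(u, r)\<in>set (octahedral_rings m). 0 < u \<and> u < 2 * ?K" by blast
qed

lemma scaled_ring_energy_cap:
  "scaled_ring_energy K (cap n) = (\<Sum>j=1..<n. K\<^sup>2 * (4 * real j * ((4 * real j)\<^sup>2 - 1) / (12 * ((real j)\<^sup>2 * (2 * K - (real j)\<^sup>2))))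
    + 16 * K * (\<Sum>i=1..<j. real i * real j / ((real j)\<^sup>2 - (real i)\<^sup>2)))"
proof (induction n)
  case (Suc n)
  show ?case
  proof (cases "n \<ge> 1")
    case True
    then have "cap (Suc n) = cap n @ [((real n)\<^sup>2, 4 * n)]" by (simp add: cap_def)
    moreover have "(\<Sum>i=1..<n. real (4 * i) * real (4 * n) / \<bar>(real i)\<^sup>2 - (real n)\<^sup>2\<bar>)
      = 16 * (\<Sum>i=1..<n. real i * real n / ((real n)\<^sup>2 - (real i)\<^sup>2))"
    proof -
      have "real (4 * i) * real (4 * n) / \<bar>(real i)\<^sup>2 - (real n)\<^sup>2\<bar>
        = 16 * (real i * real n / ((real n)\<^sup>2 - (real i)\<^sup>2))" if "i < n" for i
      proof -
        have "(real i)\<^sup>2 < (real n)\<^sup>2" using that by (simp add: power_strict_mono)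
        then have "\<bar>(real i)\<^sup>2 - (real n)\<^sup>2\<bar> = (real n)\<^sup>2 - (real i)\<^sup>2" by linarith
        then show ?thesis by simp
      qed
      then show ?thesis by (simp add: sum_distrib_left)
    qed
    ultimately show ?thesis
      using True Suc.IH by (simp add: scaled_ring_energy_append sum_list_cap)
  qed (simp add: cap_def)
qed (simp add: cap_def)

text \<open>Counting the equator with both hemispheres gives twice the sum over pairs of rings of one closed hemisphere,
plus the interaction of the two open hemispheres. The last two terms bound the self-energies, where
\<open>r * (r\<^sup>2 - 1)\<close> has been replaced by \<open>r ^ 3\<close>.\<close>

lemma scaled_ring_energy_octahedral_rings:
  assumes "m \<ge> 1"
  defines "K \<equiv> (real m)\<^sup>2"
  shows "scaled_ring_energy K (octahedral_rings m) \<le> 16 * K *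
    (2 * (\<Sum>j=1..m. \<Sum>i=1..<j. real i * real j / ((real j)\<^sup>2 - (real i)\<^sup>2))
    + (\<Sum>i=1..<m. \<Sum>j=1..<m. real i * real j / (2 * K - (real i)\<^sup>2 - (real j)\<^sup>2))
    + 2 / 3 * K * (\<Sum>j=1..<m. real j / (2 * K - (real j)\<^sup>2)) + real m / 3)"
proof -
  define row where "row j = (\<Sum>i=1..<j. real i * real j / ((real j)\<^sup>2 - (real i)\<^sup>2))" for j
  define NS where "NS = (\<Sum>i=1..<m. \<Sum>j=1..<m. real i * real j / (2 * K - (real i)\<^sup>2 - (real j)\<^sup>2))"
  have K: "K > 0" using assms by (simp add: K_def)
  have sq: "(real j)\<^sup>2 < K" if "j < m" for j using that by (simp add: K_def power_strict_mono)
  have self: "K\<^sup>2 * (4 * real j * ((4 * real j)\<^sup>2 - 1) / (12 * ((real j)\<^sup>2 * (2 * K - (real j)\<^sup>2))))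
      \<le> 16 * K * (K / 3 * (real j / (2 * K - (real j)\<^sup>2)))" if j: "1 \<le> j" "j \<le> m" for j
  proof -
    have "(real j)\<^sup>2 \<le> K" using j by (simp add: K_def power_mono)
    then have pos: "2 * K - (real j)\<^sup>2 > 0" using K by linarith
    have "4 * real j * ((4 * real j)\<^sup>2 - 1) / (12 * ((real j)\<^sup>2 * (2 * K - (real j)\<^sup>2)))
      \<le> 4 * real j * (4 * real j)\<^sup>2 / (12 * ((real j)\<^sup>2 * (2 * K - (real j)\<^sup>2)))"
      using pos by (intro divide_right_mono mult_left_mono) auto
    also have "\<dots> = 16 / 3 * (real j / (2 * K - (real j)\<^sup>2))"
      using j pos by (simp add: field_simps power2_eq_square)
    finally have "K\<^sup>2 * (4 * real j * ((4 * real j)\<^sup>2 - 1) / (12 * ((real j)\<^sup>2 * (2 * K - (real j)\<^sup>2))))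
      \<le> K\<^sup>2 * (16 / 3 * (real j / (2 * K - (real j)\<^sup>2)))"
      by (rule mult_left_mono) simp
    also have "\<dots> = 16 * K * (K / 3 * (real j / (2 * K - (real j)\<^sup>2)))"
      by (simp add: power2_eq_square)
    finally show ?thesis .
  qed
  have cap: "scaled_ring_energy K (cap m)
    \<le> 16 * K * (K / 3 * (\<Sum>j=1..<m. real j / (2 * K - (real j)\<^sup>2)) + (\<Sum>j=1..<m. row j))"
    unfolding scaled_ring_energy_cap row_def [symmetric] sum_distrib_left distrib_left sum.distrib [symmetric]
    using self by (intro sum_mono add_mono) auto
  have equator: "K\<^sup>2 * (real (4 * m) * ((real (4 * m))\<^sup>2 - 1) / (12 * (K * (2 * K - K))))
    \<le> 16 * K * (real m / 3)"
  proof -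
    have "K / 3 * (real m / (2 * K - (real m)\<^sup>2)) = real m / 3"
      using K by (simp add: K_def)
    with self [of m] assms(1) show ?thesis by (simp add: K_def)
  qed
  have meridian: "(\<Sum>(u, r)\<leftarrow>cap m. real r * real (4 * m) / \<bar>u - K\<bar>) = 16 * row m"
    unfolding sum_list_cap row_def sum_distrib_left
  proof (intro sum.cong [OF refl])
    fix j assume "j \<in> {1..<m}"
    then have "\<bar>(real j)\<^sup>2 - K\<bar> = (real m)\<^sup>2 - (real j)\<^sup>2" using sq [of j] by (simp add: K_def)
    then show "real (4 * j) * real (4 * m) / \<bar>(real j)\<^sup>2 - K\<bar>
      = 16 * (real j * real m / ((real m)\<^sup>2 - (real j)\<^sup>2))" by simp
  qed
  moreover have "real r * real (4 * m) / \<bar>u - K\<bar> = real (4 * m) * real r / \<bar>K - (2 * K - u)\<bar>" for u r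
    by simp
  ultimately have meridian': "(\<Sum>(u, r)\<leftarrow>cap m. real (4 * m) * real r / \<bar>K - (2 * K - u)\<bar>) = 16 * row m"
    by (simp only:)
  have opposite: "(\<Sum>(u, r)\<leftarrow>cap m. \<Sum>(v, s)\<leftarrow>cap m. real r * real s / \<bar>u - (2 * K - v)\<bar>) = 16 * NS"
    unfolding sum_list_cap NS_def sum_distrib_left
  proof (intro sum.cong [OF refl])
    fix i j assume "i \<in> {1..<m}" "j \<in> {1..<m}"
    then have "(real i)\<^sup>2 < K" "(real j)\<^sup>2 < K" using sq by auto
    then have "\<bar>(real i)\<^sup>2 - (2 * K - (real j)\<^sup>2)\<bar> = 2 * K - (real i)\<^sup>2 - (real j)\<^sup>2" by linarith
    then show "real (4 * i) * real (4 * j) / \<bar>(real i)\<^sup>2 - (2 * K - (real j)\<^sup>2)\<bar>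
      = 16 * (real i * real j / (2 * K - (real i)\<^sup>2 - (real j)\<^sup>2))" by simp
  qed
  have "scaled_ring_energy K (octahedral_rings m)
    = 2 * scaled_ring_energy K (cap m)
      + K\<^sup>2 * (real (4 * m) * ((real (4 * m))\<^sup>2 - 1) / (12 * (K * (2 * K - K))))
      + K * (16 * row m) + K * (16 * row m + 16 * NS)"
  proof -
    let ?S = "map (\<lambda>(u, r). (2 * K - u, r)) (cap m)"
    have split: "octahedral_rings m = cap m @ (K, 4 * m) # ?S"
      by (simp add: octahedral_rings_def K_def)
    have eq_south: "(\<Sum>(v, s)\<leftarrow>?S. real (4 * m) * real s / \<bar>K - v\<bar>) = 16 * row m"
      using meridian' by (simp add: comp_def case_prod_unfold)
    have cross: "(\<Sum>(u, r)\<leftarrow>cap m. \<Sum>(v, s)\<leftarrow>(K, 4 * m) # ?S. real r * real s / \<bar>u - v\<bar>)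
      = 16 * row m + 16 * NS"
      using meridian opposite by (simp add: comp_def case_prod_unfold sum_list_addf)
    show ?thesis
      unfolding split scaled_ring_energy_append cross scaled_ring_energy.simps eq_south
        scaled_ring_energy_reflect by simp
  qed
  also have "\<dots> \<le> 2 * (16 * K * (K / 3 * (\<Sum>j=1..<m. real j / (2 * K - (real j)\<^sup>2)) + (\<Sum>j=1..<m. row j)))
      + 16 * K * (real m / 3) + K * (16 * row m) + K * (16 * row m + 16 * NS)"
    using cap equator by (intro add_mono) auto
  also have "\<dots> = 16 * K * (2 * ((\<Sum>j=1..<m. row j) + row m) + NS
      + 2 / 3 * K * (\<Sum>j=1..<m. real j / (2 * K - (real j)\<^sup>2)) + real m / 3)"
    by (simp add: algebra_simps)
  also have "(\<Sum>j=1..<m. row j) + row m = (\<Sum>j=1..m. row j)"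
    using assms(1) by (simp add: sum.last_plus atLeastLessThanSuc_atLeastAtMost [symmetric] add.commute)
  finally show ?thesis by (simp add: row_def NS_def)
qed

section \<open>Asymptotics of the octahedral energy\<close>

text \<open>By partial fractions the summand is \<open>j / 2\<close> times \<open>1 / (j - i) - 1 / (j + i)\<close>.\<close>

lemma sum_meridian_row:
  "(\<Sum>i=1..<j. real i * real j / ((real j)\<^sup>2 - (real i)\<^sup>2))
    = real j / 2 * (2 * harm j - harm (2 * j)) - 1 / 4" if "j \<ge> 1"
proof -
  have split: "real i * real j / ((real j)\<^sup>2 - (real i)\<^sup>2)
      = real j / 2 * (inverse (real (j - i)) - inverse (real (j + i)))" if "i \<in> {1..<j}" for i
    using that by (simp add: of_nat_diff field_simps power2_eq_square)
  have "(\<Sum>i=1..<j. inverse (real (j - i))) = (\<Sum>i=1..<j. inverse (real i))"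
    by (rule sum.reindex_bij_witness [of _ "\<lambda>i. j - i" "\<lambda>i. j - i"]) auto
  also have "\<dots> = harm j - inverse (real j)"
    using that by (cases j) (simp_all add: harm_def atLeastLessThanSuc_atLeastAtMost)
  finally have minus: "(\<Sum>i=1..<j. inverse (real (j - i))) = harm j - inverse (real j)" .
  have "harm (2 * j) = harm j + (\<Sum>k=j+1..2*j. inverse (real k))"
    unfolding harm_def using that by (subst sum.union_disjoint [symmetric]) (auto intro: sum.cong)
  also have "(\<Sum>k=j+1..2*j. inverse (real k)) = (\<Sum>i=1..j. inverse (real (j + i)))"
    by (rule sum.reindex_bij_witness [of _ "\<lambda>i. j + i" "\<lambda>k. k - j"]) auto
  also have "\<dots> = (\<Sum>i=1..<j. inverse (real (j + i))) + inverse (real (j + j))"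
    using that by (simp add: sum.last_plus atLeastLessThanSuc_atLeastAtMost [symmetric] add.commute)
  finally have plus: "(\<Sum>i=1..<j. inverse (real (j + i))) = harm (2 * j) - harm j - inverse (real (j + j))"
    by simp
  have "(\<Sum>i=1..<j. real i * real j / ((real j)\<^sup>2 - (real i)\<^sup>2))
    = (\<Sum>i=1..<j. real j / 2 * (inverse (real (j - i)) - inverse (real (j + i))))"
    by (rule sum.cong [OF refl split])
  also have "\<dots> = real j / 2 * ((harm j - inverse (real j)) - (harm (2 * j) - harm j - inverse (real (j + j))))"
    by (simp only: sum_distrib_left [symmetric] sum_subtractf minus plus)
  also have "\<dots> = real j / 2 * (2 * harm j - harm (2 * j)) - 1 / 4"
    using that by (simp add: field_simps)
  finally show ?thesis .
qed

lemma sum_harm_rows: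
  "(\<Sum>j=1..m. real j / 2 * (2 * harm j - harm (2 * j)) - 1 / 4)
    = real m * (real m + 1) / 2 * (harm m - harm (2 * m) / 2) - (real m)\<^sup>2 / 8 - real m / 16
      - (harm (2 * m) - harm m / 2) / 16"
proof (induction m)
  case (Suc m)
  have h: "harm (Suc m) = harm m + 1 / (real m + 1)"
    "harm (2 * Suc m) = harm (2 * m) + 1 / (2 * real m + 1) + 1 / (2 * real m + 2)"
    by (simp_all add: harm_Suc inverse_eq_divide add_ac)
  have nz: "real m + 1 \<noteq> 0" "2 * real m + 1 \<noteq> 0" "2 * real m + 2 \<noteq> 0" by linarith+
  define a b where "a = 1 / (real m + 1)" and "b = 1 / (2 * real m + 1)"
  have c: "1 / (2 * real m + 2) = a / 2" using nz by (simp add: a_def field_simps)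
  have a: "a * real m = 1 - a" using nz by (simp add: a_def field_simps)
  have b: "b * real m = (1 - b) / 2" using nz by (simp add: b_def field_simps)
  have a2: "a * (real m * real m) = real m - 1 + a"
    using a by (metis (no_types) mult.assoc left_diff_distrib' mult_1 diff_diff_eq2 diff_add_eq add.commute)
  have b2: "b * (real m * real m) = (real m - (1 - b) / 2) / 2"
  proof -
    have "b * (real m * real m) = (b * real m) * real m" by simp
    also have "\<dots> = (1 - b) / 2 * real m" unfolding b ..
    also have "\<dots> = (real m - b * real m) / 2" by (simp add: algebra_simps)
    finally show ?thesis unfolding b .
  qed
  have "(\<Sum>j=1..Suc m. real j / 2 * (2 * harm j - harm (2 * j)) - 1 / 4)
    = (\<Sum>j=1..m. real j / 2 * (2 * harm j - harm (2 * j)) - 1 / 4)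
      + (real (Suc m) / 2 * (2 * harm (Suc m) - harm (2 * Suc m)) - 1 / 4)"
    by simp
  then show ?case
    unfolding Suc.IH h of_nat_Suc c a_def [symmetric] b_def [symmetric]
    using a b a2 b2
    by (simp add: algebra_simps power2_eq_square add_divide_distrib diff_divide_distrib)
qed (simp add: harm_expand)

text \<open>The midpoint rule for the convex function \<open>t / (A - t\<^sup>2)\<close> on an interval of length \<open>1\<close>.\<close>

lemma convex_midpoint_term:
  fixes A :: real
  assumes "i \<ge> 0" "(i + 1/2)\<^sup>2 < A"
  shows "i / (A - i\<^sup>2) \<le> (ln (A - (i - 1/2)\<^sup>2) - ln (A - (i + 1/2)\<^sup>2)) / 2"
proof (cases "i = 0")
  case False
  define x y where "x = A - (i + 1/2)\<^sup>2" and "y = A - (i - 1/2)\<^sup>2"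
  have xy: "x > 0" "y - x = 2 * i" "x + y = 2 * (A - i\<^sup>2 - 1/4)"
    using assms by (auto simp: x_def y_def power2_eq_square algebra_simps)
  have cancel: "i / d = 2 * (2 * i) / (2 * d) / 2" for d by simp
  have "i / (A - i\<^sup>2) \<le> i / (A - i\<^sup>2 - 1/4)"
    using xy assms(1) False by (intro divide_left_mono) auto
  also have "\<dots> = (2 * (y - x) / (x + y)) / 2" unfolding xy(2,3) by (rule cancel)
  also have "\<dots> \<le> (ln y - ln x) / 2"
    using ln_inverse_approx_ge [of x y] xy assms False by (intro divide_right_mono) auto
  finally show ?thesis by (simp add: x_def y_def)
qed (simp add: power2_eq_square)

lemma sum_convex_midpoint:
  fixes A :: real
  assumes "m \<ge> 1" "(real m - 1/2)\<^sup>2 < A"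
  shows "(\<Sum>j=1..<m. real j / (A - (real j)\<^sup>2)) \<le> (ln A - ln (A - (real m - 1/2)\<^sup>2)) / 2"
proof -
  have "(\<Sum>j=1..<n. real j / (A - (real j)\<^sup>2)) \<le> (ln (A - 1/4) - ln (A - (real n - 1/2)\<^sup>2)) / 2"
    if "1 \<le> n" "n \<le> m" for n
    using that
  proof (induction n rule: dec_induct)
    case (step n)
    have "(real n + 1/2)\<^sup>2 \<le> (real m - 1/2)\<^sup>2"
      using step by (intro power_mono) auto
    then have "real n / (A - (real n)\<^sup>2) \<le> (ln (A - (real n - 1/2)\<^sup>2) - ln (A - (real n + 1/2)\<^sup>2)) / 2"
      using assms(2) by (intro convex_midpoint_term) auto
    moreover have half: "real (Suc n) - 1/2 = real n + 1/2" by simp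
    moreover have last: "(\<Sum>j=1..<Suc n. real j / (A - (real j)\<^sup>2))
      = (\<Sum>j=1..<n. real j / (A - (real j)\<^sup>2)) + real n / (A - (real n)\<^sup>2)"
      using step(1) by simp
    moreover have "(\<Sum>j=1..<n. real j / (A - (real j)\<^sup>2)) \<le> (ln (A - 1/4) - ln (A - (real n - 1/2)\<^sup>2)) / 2"
      using step by simp
    ultimately show ?case unfolding half last by argo
  qed (simp add: power2_eq_square)
  from this [OF assms(1)] show ?thesis
  proof -
    have "A > 1/4"
    proof -
      have "(1/2)\<^sup>2 \<le> (real m - 1/2)\<^sup>2" using assms(1) by (intro power_mono) auto
      then show ?thesis using assms(2) by (simp add: power2_eq_square)
    qed
    then have "ln (A - 1/4) \<le> ln A" by simp
    with \<open>m \<le> m \<Longrightarrow> _\<close> show ?thesis by simp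
  qed
qed

text \<open>Up to a linear function, which cancels in the combinations below, this is the antiderivative of the logarithm.\<close>

definition xlnx :: "real \<Rightarrow> real" where "xlnx y = y * ln y"

lemma DERIV_xlnx:
  assumes "(f has_real_derivative 1) (at y)" "f y > 0"
  shows "((\<lambda>y. xlnx (f y)) has_real_derivative ln (f y) + 1) (at y)"
  unfolding xlnx_def using assms by (auto intro!: derivative_eq_intros)

text \<open>The midpoint rule for \<open>t * ln ((P - t\<^sup>2) / (Q - t\<^sup>2))\<close>. As a function of the upper parameter, the difference of
the two sides has a derivative that is nonnegative by the midpoint rule for \<open>t / (y - t\<^sup>2)\<close>, and it vanishes
for \<open>P = Q\<close>.\<close>

lemma double_midpoint_term:
  fixes P Q :: real
  assumes "i \<ge> 0" "(i + 1/2)\<^sup>2 < Q" "Q \<le> P"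
  shows "i * (ln (P - i\<^sup>2) - ln (Q - i\<^sup>2))
    \<le> (xlnx (P - (i - 1/2)\<^sup>2) - xlnx (P - (i + 1/2)\<^sup>2)
      - (xlnx (Q - (i - 1/2)\<^sup>2) - xlnx (Q - (i + 1/2)\<^sup>2))) / 2"
proof -
  define D where "D y = (xlnx (y - (i - 1/2)\<^sup>2) - xlnx (y - (i + 1/2)\<^sup>2)) / 2 - i * ln (y - i\<^sup>2)" for y
  have "D Q \<le> D P"
  proof (rule DERIV_nonneg_imp_nondecreasing [OF assms(3)])
    fix y assume y: "Q \<le> y" "y \<le> P"
    have 1: "y - (i + 1/2)\<^sup>2 > 0" using y assms by simp
    have 2: "y - (i - 1/2)\<^sup>2 > 0" using 1 assms(1) by (simp add: power2_eq_square algebra_simps)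
    have 3: "y - i\<^sup>2 > 0" using 1 assms(1) by (simp add: power2_eq_square algebra_simps)
    have "(D has_real_derivative (ln (y - (i - 1/2)\<^sup>2) + 1 - (ln (y - (i + 1/2)\<^sup>2) + 1)) / 2 - i * (1 / (y - i\<^sup>2))) (at y)"
      unfolding D_def using 1 2 3
      by (intro DERIV_diff DERIV_cdivide DERIV_cmult DERIV_xlnx) (auto intro!: derivative_eq_intros)
    moreover have "i * (1 / (y - i\<^sup>2)) \<le> (ln (y - (i - 1/2)\<^sup>2) + 1 - (ln (y - (i + 1/2)\<^sup>2) + 1)) / 2"
      using convex_midpoint_term [of i y] assms y by simp
    ultimately show "\<exists>d. (D has_real_derivative d) (at y) \<and> 0 \<le> d"
      by (metis diff_ge_0_iff_ge)
  qed
  then show ?thesis by (simp add: D_def field_simps)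
qed

lemma xlnx_diff_bounds:
  assumes "0 < x" "x \<le> y"
  shows "(y - x) * (ln x + 1) \<le> xlnx y - xlnx x" "xlnx y - xlnx x \<le> (y - x) * (ln y + 1)"
proof -
  have y: "y > 0" using assms by simp
  have "ln (x / y) \<le> x / y - 1" using assms y by (intro ln_le_minus_one) auto
  then have "y * (ln x - ln y) \<le> x - y" using assms y by (simp add: ln_div field_simps)
  then show "(y - x) * (ln x + 1) \<le> xlnx y - xlnx x" by (simp add: xlnx_def algebra_simps)
  have "ln (y / x) \<le> y / x - 1" using assms y by (intro ln_le_minus_one) auto
  then have "x * (ln y - ln x) \<le> y - x" using assms y by (simp add: ln_div field_simps)
  then show "xlnx y - xlnx x \<le> (y - x) * (ln y + 1)" by (simp add: xlnx_def algebra_simps)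
qed

text \<open>The function \<open>s * t / (2 * m\<^sup>2 - s\<^sup>2 - t\<^sup>2)\<close> is convex in each variable, so the midpoint rule bounds the sum by its
integral over the square \<open>[1/2, m - 1/2]\<^sup>2\<close>, hence over \<open>[0, m - 1/2]\<^sup>2\<close>, which is the right hand side. The
singularity \<open>(m, m)\<close> stays away from the square.\<close>

lemma sum_opposite_caps:
  assumes "m \<ge> 2"
  shows "(\<Sum>i=1..<m. \<Sum>j=1..<m. real i * real j / (2 * (real m)\<^sup>2 - (real i)\<^sup>2 - (real j)\<^sup>2))
    \<le> (xlnx (2 * (real m)\<^sup>2) - 2 * xlnx ((real m)\<^sup>2 + real m - 1/4) + xlnx (2 * real m - 1/2)) / 4"
proof -
  define P Q R where "P = 2 * (real m)\<^sup>2" and "Q = (real m)\<^sup>2 + real m - 1/4" and "R = 2 * real m - 1/2"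
  have PQ: "P - (real m - 1/2)\<^sup>2 = Q" "Q - (real m - 1/2)\<^sup>2 = R"
    by (simp_all add: P_def Q_def R_def power2_eq_square algebra_simps)
  have m: "real m \<ge> 2" using assms by simp
  have "(real m)\<^sup>2 \<ge> 2 * real m" using m by (simp add: power2_eq_square)
  then have QP: "Q \<le> P - 1/4" "Q > 1/4" unfolding P_def Q_def using m by linarith+
  have row: "(\<Sum>j=1..<m. real i * real j / (P - (real i)\<^sup>2 - (real j)\<^sup>2))
      \<le> real i * (ln (P - (real i)\<^sup>2) - ln (Q - (real i)\<^sup>2)) / 2" if "i < m" for i
  proof -
    have "(real i)\<^sup>2 \<le> (real m - 1)\<^sup>2" using that by (intro power_mono) auto
    then have "(real m - 1/2)\<^sup>2 < P - (real i)\<^sup>2"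
      using m by (simp add: P_def power2_eq_square algebra_simps)
    from sum_convex_midpoint [OF _ this] have
      "(\<Sum>j=1..<m. real j / (P - (real i)\<^sup>2 - (real j)\<^sup>2))
        \<le> (ln (P - (real i)\<^sup>2) - ln (Q - (real i)\<^sup>2)) / 2"
      using m PQ(1) by (simp add: algebra_simps)
    from mult_left_mono [OF this, of "real i"] show ?thesis
      by (simp add: sum_distrib_left)
  qed
  have tele: "(\<Sum>i=1..<n. real i * (ln (P - (real i)\<^sup>2) - ln (Q - (real i)\<^sup>2)))
      \<le> (xlnx (P - 1/4) - xlnx (P - (real n - 1/2)\<^sup>2) - (xlnx (Q - 1/4) - xlnx (Q - (real n - 1/2)\<^sup>2))) / 2"
    if "1 \<le> n" "n \<le> m" for n
    using that
  proof (induction n rule: dec_induct)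
    case (step n)
    have "(real n + 1/2)\<^sup>2 \<le> (real m - 1/2)\<^sup>2"
      using step by (intro power_mono) auto
    also have "\<dots> < Q" using m by (simp add: Q_def power2_eq_square algebra_simps)
    finally have "real n * (ln (P - (real n)\<^sup>2) - ln (Q - (real n)\<^sup>2))
      \<le> (xlnx (P - (real n - 1/2)\<^sup>2) - xlnx (P - (real n + 1/2)\<^sup>2)
        - (xlnx (Q - (real n - 1/2)\<^sup>2) - xlnx (Q - (real n + 1/2)\<^sup>2))) / 2"
      using QP by (intro double_midpoint_term) auto
    moreover have half: "real (Suc n) - 1/2 = real n + 1/2" by simp
    moreover have last: "(\<Sum>i=1..<Suc n. real i * (ln (P - (real i)\<^sup>2) - ln (Q - (real i)\<^sup>2)))
      = (\<Sum>i=1..<n. real i * (ln (P - (real i)\<^sup>2) - ln (Q - (real i)\<^sup>2)))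
        + real n * (ln (P - (real n)\<^sup>2) - ln (Q - (real n)\<^sup>2))"
      using step(1) by simp
    moreover have "(\<Sum>i=1..<n. real i * (ln (P - (real i)\<^sup>2) - ln (Q - (real i)\<^sup>2)))
      \<le> (xlnx (P - 1/4) - xlnx (P - (real n - 1/2)\<^sup>2) - (xlnx (Q - 1/4) - xlnx (Q - (real n - 1/2)\<^sup>2))) / 2"
      using step by simp
    ultimately show ?case unfolding half last by argo
  qed (simp add: power2_eq_square)
  have "(\<Sum>i=1..<m. \<Sum>j=1..<m. real i * real j / (P - (real i)\<^sup>2 - (real j)\<^sup>2))
    \<le> (\<Sum>i=1..<m. real i * (ln (P - (real i)\<^sup>2) - ln (Q - (real i)\<^sup>2)) / 2)"
    by (intro sum_mono row) auto
  also have "\<dots> \<le> (xlnx (P - 1/4) - xlnx Q - (xlnx (Q - 1/4) - xlnx R)) / 4"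
    using tele [of m] assms by (simp add: PQ sum_divide_distrib [symmetric])
  also have "\<dots> \<le> (xlnx P - xlnx Q - (xlnx Q - xlnx R)) / 4"
  proof -
    have "xlnx Q - xlnx (Q - 1/4) \<le> (1/4) * (ln Q + 1)"
      using xlnx_diff_bounds(2) [of "Q - 1/4" Q] QP by simp
    also have "\<dots> \<le> (1/4) * (ln (P - 1/4) + 1)" using QP by simp
    also have "\<dots> \<le> xlnx P - xlnx (P - 1/4)"
      using xlnx_diff_bounds(1) [of "P - 1/4" P] QP by simp
    finally show ?thesis by simp
  qed
  finally show ?thesis by (simp add: P_def Q_def R_def)
qed

text \<open>Write \<open>x = m\<close> and \<open>l = ln m\<close>. To leading order the three sums are \<open>x\<^sup>2 / 2 * (l + \<gamma> - ln 2 - 1 / 2)\<close>,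
\<open>x\<^sup>2 / 2 * ln 2\<close> and \<open>x\<^sup>2 / 3 * ln 2\<close>; the terms in \<open>x * l\<close> of the first two cancel. What remains to be
compared with the right hand side is a negative multiple of \<open>x\<^sup>2\<close> against a linear function of \<open>x\<close>, and
the quadratic term prevails from \<open>x = 12\<close> on, even with \<open>1 / 100\<close> to spare.\<close>

lemma octahedral_sums_upper_bound:
  assumes "m \<ge> 12"
  defines "K \<equiv> (real m)\<^sup>2"
  shows "2 * (\<Sum>j=1..m. \<Sum>i=1..<j. real i * real j / ((real j)\<^sup>2 - (real i)\<^sup>2))
    + (\<Sum>i=1..<m. \<Sum>j=1..<m. real i * real j / (2 * K - (real i)\<^sup>2 - (real j)\<^sup>2))
    + 2 / 3 * K * (\<Sum>j=1..<m. real j / (2 * K - (real j)\<^sup>2)) + real m / 3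
    \<le> K / 4 * (ln (4 * (real m - 1)\<^sup>2) - 1 / 100)"
proof -
  define x l c where "x = real m" and "l = ln x" and "c = ln (2 :: real)"
  have x: "x \<ge> 12" using assms by (simp add: x_def)
  have xx: "x * x \<ge> 12 * x" using x by simp
  have K: "K = x * x" by (simp add: K_def x_def power2_eq_square)
  define Q R where "Q = x * x + x - 1/4" and "R = 2 * x - 1/2"
  have Q: "Q > 0" "Q > x * x" unfolding Q_def using x xx by linarith+
  have c: "c \<ge> 693 / 1000"
    using ln_approx_bounds [of 2 3] by (simp add: c_def eval_nat_numeral)
  \<comment> \<open>This bound exceeds the constant by about \<open>0.014\<close>, which the margin allows.\<close>
  have g: "euler_mascheroni < (13 / 22 :: real)" by (rule euler_mascheroni_less_13_over_22)
  have lnK: "ln (x * x) = 2 * l" using x by (simp add: l_def ln_mult)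
  have lnP: "ln (2 * (x * x)) = c + 2 * l" using x by (simp add: l_def c_def ln_mult)

  have meridian: "2 * (\<Sum>j=1..m. \<Sum>i=1..<j. real i * real j / ((real j)\<^sup>2 - (real i)\<^sup>2))
    \<le> (x * x + x) / 2 * (l - c + 13 / 22) + 3 / 8 * x + 21 / 20 - x * x / 4 - x / 8"
  proof -
    have split: "e * (13 / 22 + l - c + d) = e * (l - c + 13 / 22) + e * d" for d e
      by (simp add: algebra_simps)
    have harm_le: "2 * harm m - harm (2 * m)
      \<le> 13 / 22 + (2 * ln (x + 1) - ln (2 * x + 1)) - 1 / (x + 1) + 1 / (4 * x)"
    proof -
      define p where "p = 1 / (x + 1)"
      have "harm m \<le> euler_mascheroni + ln (x + 1) - p / 2"
      proof -
        have e: "inverse (real (2 * (m + 1))) = p / 2" "real (Suc m) = x + 1"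
          by (simp_all add: p_def x_def field_simps)
        have "harm m - ln (real (Suc m)) + inverse (real (2 * (m + 1))) \<le> euler_mascheroni"
          using euler_mascheroni_bounds [of m] assms(1) by simp
        then show ?thesis unfolding e by linarith
      qed
      moreover have "euler_mascheroni + ln (2 * x + 1) - 1 / (4 * x) \<le> harm (2 * m)"
        using euler_mascheroni_bounds [of "2 * m"] assms(1) by (simp add: x_def inverse_eq_divide add_ac)
      ultimately show ?thesis using g unfolding p_def [symmetric] by linarith
    qed
    have "2 * ln (x + 1) - ln (2 * x + 1) - l + c = ln (2 * ((x + 1) * (x + 1)) / (x * (2 * x + 1)))"
      using x by (simp add: l_def c_def ln_mult ln_div)
    also have "\<dots> \<le> 2 * ((x + 1) * (x + 1)) / (x * (2 * x + 1)) - 1"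
      using x by (intro ln_le_minus_one divide_pos_pos mult_pos_pos) auto
    also have "\<dots> = (3 * x + 2) / (x * (2 * x + 1))"
    proof -
      have "x \<noteq> 0" "2 * x + 1 \<noteq> 0" using x by auto
      then show ?thesis by (simp add: divide_simps) (simp add: algebra_simps)
    qed
    finally have "2 * harm m - harm (2 * m)
      \<le> 13 / 22 + l - c + ((3 * x + 2) / (x * (2 * x + 1)) - 1 / (x + 1) + 1 / (4 * x))"
      using harm_le by linarith
    then have "(x * x + x) / 2 * (2 * harm m - harm (2 * m))
      \<le> (x * x + x) / 2 * (13 / 22 + l - c + ((3 * x + 2) / (x * (2 * x + 1)) - 1 / (x + 1) + 1 / (4 * x)))"
      using x by (intro mult_left_mono) auto
    also have "\<dots> = (x * x + x) / 2 * (l - c + 13 / 22)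
      + (x * x + x) / 2 * ((3 * x + 2) / (x * (2 * x + 1)) - 1 / (x + 1) + 1 / (4 * x))"
      by (rule split)
    also have "(x * x + x) / 2 * ((3 * x + 2) / (x * (2 * x + 1)) - 1 / (x + 1) + 1 / (4 * x))
      = 3 / 8 * x + 7 / 8 + (x + 1) / (4 * (2 * x + 1))"
    proof -
      have "x \<noteq> 0" "x + 1 \<noteq> 0" "2 * x + 1 \<noteq> 0" using x by auto
      then show ?thesis by (simp add: divide_simps) (simp add: algebra_simps)
    qed
    also have "(x + 1) / (4 * (2 * x + 1)) \<le> 7 / 40"
      using x by (simp add: divide_simps)
    finally have main: "(x * x + x) / 2 * (2 * harm m - harm (2 * m))
      \<le> (x * x + x) / 2 * (l - c + 13 / 22) + 3 / 8 * x + 21 / 20" by simp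
    \<comment> \<open>This difference enters the closed form of the sum with a negative sign.\<close>
    have mono: "harm (2 * m) - harm m / 2 \<ge> (0 :: real)"
      using harm_mono [of m "2 * m", where 'a = real] harm_nonneg [of m, where 'a = real] by linarith
    have "(\<Sum>j=1..m. \<Sum>i=1..<j. real i * real j / ((real j)\<^sup>2 - (real i)\<^sup>2))
      = (\<Sum>j=1..m. real j / 2 * (2 * harm j - harm (2 * j)) - 1 / 4)"
      by (intro sum.cong [OF refl] sum_meridian_row) auto
    also have "\<dots> = x * (x + 1) / 2 * (harm m - harm (2 * m) / 2) - x * x / 8 - x / 16
      - (harm (2 * m) - harm m / 2) / 16"
      unfolding sum_harm_rows x_def power2_eq_square ..
    finally have eq: "2 * (\<Sum>j=1..m. \<Sum>i=1..<j. real i * real j / ((real j)\<^sup>2 - (real i)\<^sup>2))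
      = (x * x + x) / 2 * (2 * harm m - harm (2 * m)) - x * x / 4 - x / 8
        - (harm (2 * m) - harm m / 2) / 8"
      by (simp add: field_simps)
    have "s \<le> e' + a' + b' - a - b"
      if "s = e - a - b - h / 8" "e \<le> e' + a' + b'" "h \<ge> 0" for s e a b h e' a' b' :: real
      using that by linarith
    from this [OF eq main mono] show ?thesis .
  qed

  have opposite: "(\<Sum>i=1..<m. \<Sum>j=1..<m. real i * real j / (2 * K - (real i)\<^sup>2 - (real j)\<^sup>2))
    \<le> (2 * (x * x) * (c + 2 * l) - 2 * (2 * l * Q + x - 1/4) + R * (c + l)) / 4"
  proof -
    have "(\<Sum>i=1..<m. \<Sum>j=1..<m. real i * real j / (2 * K - (real i)\<^sup>2 - (real j)\<^sup>2))
      \<le> (xlnx (2 * (x * x)) - 2 * xlnx Q + xlnx R) / 4"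
      using sum_opposite_caps [of m] assms(1)
      by (simp add: K_def Q_def R_def x_def power2_eq_square)
    moreover have "xlnx Q \<ge> 2 * l * Q + x - 1/4"
      using xlnx_diff_bounds(1) [of "x * x" Q] Q x lnK
      by (simp add: xlnx_def Q_def algebra_simps)
    moreover have "xlnx R \<le> R * (c + l)"
    proof -
      have "ln R \<le> ln (2 * x)" using x by (simp add: R_def)
      also have "\<dots> = c + l" using x by (simp add: c_def l_def ln_mult)
      finally show ?thesis using x by (simp add: xlnx_def R_def)
    qed
    ultimately show ?thesis by (simp add: xlnx_def lnP)
  qed

  have self: "2 / 3 * K * (\<Sum>j=1..<m. real j / (2 * K - (real j)\<^sup>2)) \<le> x * x * c / 3 - x / 3 + 1 / 4"
  proof -
    have sq: "(real m - 1/2)\<^sup>2 = x * x - x + 1/4"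
      by (simp add: x_def power2_eq_square algebra_simps)
    have "(real m - 1/2)\<^sup>2 < 2 * K"
      unfolding sq K using x xx by linarith
    from sum_convex_midpoint [OF _ this] have "(\<Sum>j=1..<m. real j / (2 * K - (real j)\<^sup>2)) \<le> (ln (2 * (x * x)) - ln Q) / 2"
      using assms(1) by (simp add: K Q_def x_def [symmetric] power2_eq_square algebra_simps)
    then have "2 / 3 * K * (\<Sum>j=1..<m. real j / (2 * K - (real j)\<^sup>2)) \<le> 2 / 3 * (x * x) * ((ln (2 * (x * x)) - ln Q) / 2)"
      unfolding K by (rule mult_left_mono) simp
    also have "\<dots> = x * x * c / 3 - x * x * (ln Q - ln (x * x)) / 3"
      unfolding lnP lnK by (simp add: field_simps)
    also have "\<dots> \<le> x * x * c / 3 - (x - 3 / 4) / 3"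
    proof -
      have "ln Q - ln (x * x) \<ge> 2 * (Q - x * x) / (x * x + Q)"
        using Q x by (intro ln_inverse_approx_ge) auto
      then have "x * x * (ln Q - ln (x * x)) \<ge> x * x * (2 * (Q - x * x) / (x * x + Q))"
        by (rule mult_left_mono) simp
      moreover have "x * x * (2 * (Q - x * x) / (x * x + Q)) \<ge> x - 3 / 4"
      proof -
        have "(x - 3 / 4) * (x * x + Q) \<le> x * x * (2 * (Q - x * x))"
          using x by (simp add: Q_def algebra_simps)
        moreover have "x * x + Q > 0" using Q x by (intro add_pos_pos) auto
        ultimately show ?thesis unfolding times_divide_eq_right by (subst pos_le_divide_eq) auto
      qed
      ultimately have "x - 3 / 4 \<le> x * x * (ln Q - ln (x * x))"
        by (rule order_trans [rotated])
      then show ?thesis by (intro diff_left_mono divide_right_mono) auto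
    qed
    also have "\<dots> = x * x * c / 3 - x / 3 + 1 / 4" by (simp add: diff_divide_distrib)
    finally show ?thesis .
  qed

  \<comment> \<open>The constant is \<open>2\<close> times the trapezoidal bound \<open>(1 / 11 + 1 / 12) / 2\<close> for \<open>ln (12 / 11)\<close>.\<close>
  have target: "ln (4 * (real m - 1)\<^sup>2) \<ge> 2 * c + 2 * l - 23 / 132"
  proof -
    have "ln x - ln (x - 1) \<le> (inverse (x - 1) + inverse x) / 2"
      using ln_inverse_approx_le [of "x - 1" 1] x by simp
    also have "\<dots> \<le> (1 / 11 + 1 / 12) / 2"
      using x by (intro divide_right_mono add_mono) (auto simp: field_simps)
    finally have "ln (x - 1) \<ge> l - 23 / 264" by (simp add: l_def)
    moreover have "ln (4 * (x - 1)\<^sup>2) = 2 * c + 2 * ln (x - 1)"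
    proof -
      have "4 * (x - 1)\<^sup>2 = (2 * (x - 1))\<^sup>2" by (simp add: power2_eq_square algebra_simps)
      then have "ln (4 * (x - 1)\<^sup>2) = 2 * ln (2 * (x - 1))"
        using ln_realpow [of "2 * (x - 1)" 2] x by (simp only: of_nat_numeral)
      also have "ln (2 * (x - 1)) = c + ln (x - 1)"
        unfolding c_def using x by (intro ln_mult_pos) auto
      finally show ?thesis by simp
    qed
    ultimately show ?thesis by (simp add: x_def)
  qed
  have goal_ge: "K / 4 * (ln (4 * (real m - 1)\<^sup>2) - 1 / 100) \<ge> x * x / 4 * (2 * c + 2 * l - 23 / 132 - 1 / 100)"
    unfolding K using target by (intro mult_left_mono) auto
  have poly: "(x * x + x) / 2 * (l - c + 13 / 22) + 3 / 8 * x + 21 / 20 - x * x / 4 - x / 8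
    + (2 * (x * x) * (c + 2 * l) - 2 * (2 * l * Q + x - 1/4) + R * (c + l)) / 4
    + (x * x * c / 3 - x / 3 + 1 / 4) + x / 3
    \<le> x * x / 4 * (2 * c + 2 * l - 23 / 132 - 1 / 100)" (is "?lhs \<le> ?rhs")
  proof -
    have "?lhs - ?rhs = (13 / 44 - 1 / 4 + 23 / 528 + 1 / 400) * (x * x) - c * (x * x) / 6
      + (13 / 44 - 1 / 4) * x + l / 8 - c / 8 + 57 / 40"
      by (simp add: Q_def R_def field_simps)
    also have "\<dots> \<le> (13 / 44 - 1 / 4 + 23 / 528 + 1 / 400) * (x * x) - 693 / 1000 * (x * x) / 6
      + (13 / 44 - 1 / 4) * x + (x - 1) / 8 - 693 / 1000 / 8 + 57 / 40"
      using c ln_le_minus_one [of x] x unfolding l_def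
      by (intro add_mono diff_mono divide_right_mono mult_right_mono order_refl) auto
    also have "\<dots> \<le> 0"
    proof -
      have "(13 / 44 - 1 / 4 + 23 / 528 + 1 / 400) * y - 693 / 1000 * y / 6
        + (13 / 44 - 1 / 4) * x + (x - 1) / 8 - 693 / 1000 / 8 + 57 / 40 \<le> 0" if "12 * x \<le> y" for y
        using that x by (simp add: field_simps)
      then show ?thesis using xx .
    qed
    finally show ?thesis by simp
  qed
  show ?thesis
    unfolding x_def [symmetric]
    by (rule order_trans [OF add_right_mono [OF add_mono [OF add_mono [OF meridian opposite] self]]
          order_trans [OF poly goal_ge [unfolded x_def [symmetric]]]])
qed

lemma min_riesz_2_energy_octahedral:
  assumes "m \<ge> 12"
  shows "min_riesz_2_energy (4 * m\<^sup>2) \<le> (real (4 * m\<^sup>2))\<^sup>2 / 4 * (ln (4 * (real m - 1)\<^sup>2) - 1 / 100)"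
proof -
  have "min_riesz_2_energy (4 * m\<^sup>2) \<le> scaled_ring_energy ((real m)\<^sup>2) (octahedral_rings m)"
  proof (rule min_riesz_2_energy_le_scaled)
    show "\<forall>(u, r)\<in>set (octahedral_rings m). (0 < u \<and> u < 2 * (real m)\<^sup>2) \<or> ((u = 0 \<or> u = 2 * (real m)\<^sup>2) \<and> r = 1)"
      using octahedral_rings_heights(2) [of m] assms by auto
  qed (use assms octahedral_rings_heights(1) [of m] card_octahedral_rings [of m] in auto)
  also have "\<dots> \<le> 16 * (real m)\<^sup>2 * ((real m)\<^sup>2 / 4 * (ln (4 * (real m - 1)\<^sup>2) - 1 / 100))"
    using octahedral_sums_upper_bound [OF assms] assms
    by (intro order_trans [OF scaled_ring_energy_octahedral_rings] mult_left_mono) auto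
  also have "\<dots> = (real (4 * m\<^sup>2))\<^sup>2 / 4 * (ln (4 * (real m - 1)\<^sup>2) - 1 / 100)"
    by (simp add: power2_eq_square)
  finally show ?thesis .
qed

text \<open>Points are deleted from the octahedral configuration of the next larger size \<open>4 * m\<^sup>2\<close>. For its energy bound the
logarithm is already taken at the previous size \<open>4 * (m - 1)\<^sup>2 < N\<close>.\<close>

lemma min_riesz_2_energy_le_large:
  assumes "N > 484"
  shows "min_riesz_2_energy N \<le> (real N)\<^sup>2 / 4 * (ln (real N) - 1 / 100)"
proof -
  \<comment> \<open>The least \<open>m\<close> makes \<open>4 * (m - 1)\<^sup>2\<close> smaller than \<open>N\<close>, and \<open>N > 484 = 4 * 11\<^sup>2\<close> makes it at least \<open>12\<close>.\<close>
  define m where "m = (LEAST m. N \<le> 4 * m\<^sup>2)"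
  have "N \<le> 4 * N\<^sup>2" by (simp add: power2_eq_square)
  then have m: "N \<le> 4 * m\<^sup>2" unfolding m_def by (rule LeastI)
  have "m \<ge> 12"
  proof (rule ccontr)
    assume "\<not> ?thesis"
    then have "m\<^sup>2 \<le> 11\<^sup>2" by (intro power_mono) auto
    then show False using m assms by simp
  qed
  have "\<not> N \<le> 4 * (m - 1)\<^sup>2"
    using not_less_Least [of "m - 1" "\<lambda>m. N \<le> 4 * m\<^sup>2"] \<open>m \<ge> 12\<close> by (simp add: m_def)
  then have "real (4 * (m - 1)\<^sup>2) \<le> real N" by (simp only: of_nat_le_iff)
  then have pred: "4 * (real m - 1)\<^sup>2 \<le> real N" using \<open>m \<ge> 12\<close> by (simp add: of_nat_diff)
  define M where "M = 4 * m\<^sup>2"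
  have NM: "N \<le> M" using m by (simp add: M_def)
  define w where "w = ln (4 * (real m - 1)\<^sup>2) - 1 / 100"
  have w: "0 \<le> w" "w \<le> ln (real N) - 1 / 100"
  proof -
    have pos: "(real m - 1)\<^sup>2 \<ge> 1" using \<open>m \<ge> 12\<close> by simp
    show "w \<le> ln (real N) - 1 / 100" 
    proof -
      have "ln (4 * (real m - 1)\<^sup>2) \<le> ln (real N)"
        using pred pos by (intro ln_mono) auto
      then show ?thesis by (simp add: w_def)
    qed
    have "ln (4 :: real) \<le> ln (4 * (real m - 1)\<^sup>2)"
      by (rule ln_mono) (use pos in auto)
    moreover have "ln (4 :: real) \<ge> 1 / 100" using ln2_ge_two_thirds ln_mono [of 2 "4::real"] by linarith
    ultimately show "0 \<le> w" by (simp add: w_def)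
  qed
  have M: "real M * (real M - 1) > 0" using NM assms by simp
  have "min_riesz_2_energy N \<le> real N * (real N - 1) * (min_riesz_2_energy M / (real M * (real M - 1)))"
    using assms NM by (intro min_riesz_2_energy_scaled_mono) auto
  also have "\<dots> \<le> real N * (real N - 1) * ((real M)\<^sup>2 / 4 * w / (real M * (real M - 1)))"
    using assms M min_riesz_2_energy_octahedral [OF \<open>m \<ge> 12\<close>]
    by (intro mult_left_mono divide_right_mono) (auto simp: M_def w_def)
  also have "\<dots> = real N / 4 * w * ((real N - 1) * real M / (real M - 1))"
    using M by (simp add: power2_eq_square)
  also have "\<dots> \<le> real N / 4 * w * real N"
  proof (rule mult_left_mono)
    have "(real N - 1) * real M \<le> real N * (real M - 1)" using NM by (simp add: algebra_simps)
    then show "(real N - 1) * real M / (real M - 1) \<le> real N"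
      using assms NM by (simp add: pos_divide_le_eq)
  qed (use w in auto)
  also have "\<dots> = (real N)\<^sup>2 / 4 * w" by (simp add: power2_eq_square)
  also have "\<dots> \<le> (real N)\<^sup>2 / 4 * (ln (real N) - 1 / 100)"
    using w by (intro mult_left_mono) auto
  finally show ?thesis .
qed

section \<open>Small configurations\<close>

text \<open>Explicit bounds for the logarithms of the integers without prime factors above \<open>7\<close>. Such integers are dense
enough to serve as left end points of the ranges of \<open>N\<close> below.\<close>

lemma ln_smooth_ge:
  "real a * (693147 / 1000000) + real b * (1098612 / 1000000) + real c * (1609437 / 1000000)
    + real d * (1945909 / 1000000) \<le> ln (2 ^ a * 3 ^ b * 5 ^ c * 7 ^ d :: real)"
proof -
  have 2: "ln 2 \<ge> (693147 / 1000000 :: real)"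
    using ln_approx_bounds [of 2 6] by (simp add: eval_nat_numeral)
  \<comment> \<open>The logarithms of \<open>3\<close>, \<open>5\<close> and \<open>7\<close> come from the quotients \<open>3/2\<close>, \<open>5/4\<close> and \<open>7/6\<close>, for which the series converges fast.\<close>
  have "ln (3 / 2) \<ge> (405465 / 1000000 :: real)"
    using ln_approx_bounds [of "3/2" 6] by (simp add: eval_nat_numeral)
  then have 3: "ln 3 \<ge> (1098612 / 1000000 :: real)"
    using ln_mult [of "2 :: real" "3/2"] 2 by simp
  have "ln (5 / 4) \<ge> (223143 / 1000000 :: real)"
    using ln_approx_bounds [of "5/4" 5] by (simp add: eval_nat_numeral)
  then have 5: "ln 5 \<ge> (1609437 / 1000000 :: real)"
    using ln_mult [of "2 * 2 :: real" "5/4"] ln_mult [of 2 "2 :: real"] 2 by simp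
  have "ln (7 / 6) \<ge> (154150 / 1000000 :: real)"
    using ln_approx_bounds [of "7/6" 5] by (simp add: eval_nat_numeral)
  then have 7: "ln 7 \<ge> (1945909 / 1000000 :: real)"
    using ln_mult [of "2 * 3 :: real" "7/6"] ln_mult [of 2 "3 :: real"] 2 3 by simp
  have "ln (2 ^ a * 3 ^ b * 5 ^ c * 7 ^ d :: real) = real a * ln 2 + real b * ln 3 + real c * ln 5 + real d * ln 7"
    by (simp add: ln_mult ln_realpow)
  moreover have "real a * (693147 / 1000000) \<le> real a * ln 2" using 2 by (intro mult_left_mono) auto
  moreover have "real b * (1098612 / 1000000) \<le> real b * ln 3" using 3 by (intro mult_left_mono) auto
  moreover have "real c * (1609437 / 1000000) \<le> real c * ln 5" using 5 by (intro mult_left_mono) auto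
  moreover have "real d * (1945909 / 1000000) \<le> real d * ln 7" using 7 by (intro mult_left_mono) auto
  ultimately show ?thesis by linarith
qed

text \<open>Deleting points from a configuration of size \<open>M\<close> bounds the energy at \<open>N\<close> by \<open>N / 4\<close> times a linear function
\<open>(N - 1) * t\<close>, and it suffices to compare this line with the convex function \<open>N * ln N\<close> at the left end \<open>L\<close>: there
the slope \<open>ln L + 1\<close> of the latter exceeds \<open>t\<close>.\<close>

lemma min_riesz_2_energy_less_on_range:
  assumes "min_riesz_2_energy M \<le> B" "2 \<le> L" "L \<le> N" "N \<le> M"
    and "l \<le> ln (real L)" "(real L - 1) * (4 * B) < real L * l * (real M * (real M - 1))"
  shows "min_riesz_2_energy N < (real N)\<^sup>2 / 4 * ln (real N)"
proof -
  have M: "real M * (real M - 1) > 0" using assms by simp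
  define t where "t = 4 * B / (real M * (real M - 1))"
  have "(real L - 1) * t < real L * l"
    using assms(6) M by (simp add: t_def pos_divide_less_eq)
  also have "\<dots> \<le> real L * ln (real L)" using assms(5) by (intro mult_left_mono) auto
  finally have tL: "(real L - 1) * t < real L * ln (real L)" .
  have "ln (real L) \<le> real L - 1" using assms by (intro ln_le_minus_one) auto
  then have "(real L - 1) * t < (real L - 1) * (ln (real L) + 1)"
    using tL by (simp add: algebra_simps)
  then have "t < ln (real L) + 1" using assms by (simp add: mult_less_cancel_left)
  then have "(real N - real L) * t \<le> (real N - real L) * (ln (real L) + 1)"
    using assms by (intro mult_left_mono) auto
  moreover have "real N * ln (real N) \<ge> real N * ln (real L) + real N - real L"
  proof -
    have "ln (real L / real N) \<le> real L / real N - 1" using assms by (intro ln_le_minus_one) auto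
    then show ?thesis using assms by (simp add: ln_div field_simps)
  qed
  ultimately have "(real N - 1) * t < real N * ln (real N)"
    using tL by (simp add: algebra_simps)
  have "min_riesz_2_energy N \<le> real N * (real N - 1) * (min_riesz_2_energy M / (real M * (real M - 1)))"
    using assms by (intro min_riesz_2_energy_scaled_mono) auto
  also have "\<dots> \<le> real N * (real N - 1) * (B / (real M * (real M - 1)))"
    using assms M by (intro mult_left_mono divide_right_mono) auto
  also have "\<dots> = real N / 4 * ((real N - 1) * t)" by (simp add: t_def)
  also have "\<dots> < real N / 4 * (real N * ln (real N))"
    using \<open>(real N - 1) * t < real N * ln (real N)\<close> assms by (intro mult_strict_left_mono) auto
  finally show ?thesis by (simp add: power2_eq_square)
qed

lemma min_riesz_2_energy_less_extend:
  assumes "\<forall>N\<in>{2..n}. min_riesz_2_energy N < (real N)\<^sup>2 / 4 * ln (real N)"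
    and "min_riesz_2_energy M \<le> B"
    and "2 \<le> (2 ^ a * 3 ^ b * 5 ^ c * 7 ^ d :: nat)" "2 ^ a * 3 ^ b * 5 ^ c * 7 ^ d \<le> n + 1"
    and "(2 ^ a * 3 ^ b * 5 ^ c * 7 ^ d - 1) * (4 * B) < 2 ^ a * 3 ^ b * 5 ^ c * 7 ^ d
      * (real a * (693147 / 1000000) + real b * (1098612 / 1000000) + real c * (1609437 / 1000000)
        + real d * (1945909 / 1000000)) * (real M * (real M - 1))"
  shows "\<forall>N\<in>{2..M}. min_riesz_2_energy N < (real N)\<^sup>2 / 4 * ln (real N)"
proof
  fix N assume N: "N \<in> {2..M}"
  let ?L = "2 ^ a * 3 ^ b * 5 ^ c * 7 ^ d :: nat"
  show "min_riesz_2_energy N < (real N)\<^sup>2 / 4 * ln (real N)"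
  proof (cases "N \<le> n")
    case False
    show ?thesis
    proof (rule min_riesz_2_energy_less_on_range [OF assms(2,3)])
      show "?L \<le> N" "N \<le> M" using assms(4) False N by auto
      show "real a * (693147 / 1000000) + real b * (1098612 / 1000000) + real c * (1609437 / 1000000)
          + real d * (1945909 / 1000000) \<le> ln (real ?L)"
        using ln_smooth_ge [of a b c d] by simp
    qed (use assms(5) in simp)
  qed (use assms(1) N in auto)
qed

text \<open>In this and the following fourteen systems the sizes of the rings are roughly proportional to the lengths of the
parallels. With \<open>a\<close> points on the rings
above it and \<open>K\<close> the total number of points, a ring of \<open>r\<close> points has the position \<open>2 * a + r\<close>, the middle of its band in terms of area;
a single point at an end is moved to the pole. The right hand sides are the energies, rounded up if necessary.\<close>

lemma min_riesz_2_energy_3: "min_riesz_2_energy 3 \<le> 2"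
proof -
  have "min_riesz_2_energy 3 \<le> scaled_ring_energy 3
    [(3, 3)]"
    by (rule min_riesz_2_energy_le_scaled) simp_all
  also have "\<dots> \<le> 2" by simp
  finally show ?thesis .
qed

lemma min_riesz_2_energy_6: "min_riesz_2_energy 6 \<le> 27/2"
proof -
  have "min_riesz_2_energy 6 \<le> scaled_ring_energy 6
    [(0, 1), (6, 4), (12, 1)]"
    by (rule min_riesz_2_energy_le_scaled) simp_all
  also have "\<dots> \<le> 27/2" by simp
  finally show ?thesis .
qed

lemma min_riesz_2_energy_10: "min_riesz_2_energy 10 \<le> 5067/100"
proof -
  have "min_riesz_2_energy 10 \<le> scaled_ring_energy 10
    [(0, 1), (7, 5), (16, 4)]"
    by (rule min_riesz_2_energy_le_scaled) simp_all
  also have "\<dots> \<le> 5067/100" by simp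
  finally show ?thesis .
qed

lemma min_riesz_2_energy_14: "min_riesz_2_energy 14 \<le> 5739/50"
proof -
  have "min_riesz_2_energy 14 \<le> scaled_ring_energy 14
    [(0, 1), (8, 6), (20, 6), (28, 1)]"
    by (rule min_riesz_2_energy_le_scaled) simp_all
  also have "\<dots> \<le> 5739/50" by simp
  finally show ?thesis .
qed

lemma min_riesz_2_energy_21: "min_riesz_2_energy 21 \<le> 30293/100"
proof -
  have "min_riesz_2_energy 21 \<le> scaled_ring_energy 21
    [(0, 1), (8, 6), (21, 7), (34, 6), (42, 1)]"
    by (rule min_riesz_2_energy_le_scaled) simp_all
  also have "\<dots> \<le> 30293/100" by simp
  finally show ?thesis .
qed

lemma min_riesz_2_energy_28: "min_riesz_2_energy 28 \<le> 59529/100"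
proof -
  have "min_riesz_2_energy 28 \<le> scaled_ring_energy 28
    [(5, 5), (19, 9), (37, 9), (51, 5)]"
    by (rule min_riesz_2_energy_le_scaled) simp_all
  also have "\<dots> \<le> 59529/100" by simp
  finally show ?thesis .
qed

lemma min_riesz_2_energy_39: "min_riesz_2_energy 39 \<le> 127747/100"
proof -
  have "min_riesz_2_energy 39 \<le> scaled_ring_energy 39
    [(5, 5), (19, 9), (39, 11), (59, 9), (73, 5)]"
    by (rule min_riesz_2_energy_le_scaled) simp_all
  also have "\<dots> \<le> 127747/100" by simp
  finally show ?thesis .
qed

lemma min_riesz_2_energy_55: "min_riesz_2_energy 55 \<le> 13987/5"
proof -
  have "min_riesz_2_energy 55 \<le> scaled_ring_energy 55
    [(0, 1), (10, 8), (30, 12), (55, 13), (80, 12), (100, 8), (110, 1)]"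
    by (rule min_riesz_2_energy_le_scaled) simp_all
  also have "\<dots> \<le> 13987/5" by simp
  finally show ?thesis .
qed

lemma min_riesz_2_energy_78: "min_riesz_2_energy 78 \<le> 30717/5"
proof -
  have "min_riesz_2_energy 78 \<le> scaled_ring_energy 78
    [(0, 1), (8, 6), (25, 11), (50, 14), (78, 14), (106, 14), (131, 11), (148, 6), (156, 1)]"
    by (rule min_riesz_2_energy_le_scaled) simp_all
  also have "\<dots> \<le> 30717/5" by simp
  finally show ?thesis .
qed

lemma min_riesz_2_energy_104: "min_riesz_2_energy 104 \<le> 58436/5"
proof -
  have "min_riesz_2_energy 104 \<le> scaled_ring_energy 104
    [(0, 1), (9, 7), (28, 12), (55, 15), (87, 17), (121, 17), (153, 15), (180, 12), (199, 7), (208, 1)]"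
    by (rule min_riesz_2_energy_le_scaled) simp_all
  also have "\<dots> \<le> 58436/5" by simp
  finally show ?thesis .
qed

lemma min_riesz_2_energy_146: "min_riesz_2_energy 146 \<le> 248367/10"
proof -
  have "min_riesz_2_energy 146 \<le> scaled_ring_energy 146
    [(0, 1), (8, 6), (25, 11), (52, 16), (87, 19), (126, 20), (166, 20), (205, 19), (240, 16), (267, 11), (284, 6), (292, 1)]"
    by (rule min_riesz_2_energy_le_scaled) simp_all
  also have "\<dots> \<le> 248367/10" by simp
  finally show ?thesis .
qed

lemma min_riesz_2_energy_204: "min_riesz_2_energy 204 \<le> 259881/5"
proof -
  have "min_riesz_2_energy 204 \<le> scaled_ring_energy 204
    [(3, 3), (15, 9), (38, 14), (70, 18), (110, 22), (156, 24), (204, 24), (252, 24), (298, 22), (338, 18), (370, 14), (393, 9), (405, 3)]"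
    by (rule min_riesz_2_energy_le_scaled) simp_all
  also have "\<dots> \<le> 259881/5" by simp
  finally show ?thesis .
qed

lemma min_riesz_2_energy_276: "min_riesz_2_energy 276 \<le> 1008121/10"
proof -
  have "min_riesz_2_energy 276 \<le> scaled_ring_energy 276
    [(0, 1), (8, 6), (26, 12), (55, 17), (93, 21), (139, 25), (191, 27), (247, 29), (305, 29), (361, 27), (413, 25), (459, 21), (497, 17), (526, 12), (544, 6), (552, 1)]"
    by (rule min_riesz_2_energy_le_scaled) simp_all
  also have "\<dots> \<le> 1008121/10" by simp
  finally show ?thesis .
qed

lemma min_riesz_2_energy_373: "min_riesz_2_energy 373 \<le> 1946963/10"
proof -
  have "min_riesz_2_energy 373 \<le> scaled_ring_energy 373
    [(3, 3), (15, 9), (39, 15), (75, 21), (122, 26), (177, 29), (238, 32), (304, 34), (373, 35), (442, 34), (508, 32), (569, 29), (624, 26), (671, 21), (707, 15), (731, 9), (743, 3)]"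
    by (rule min_riesz_2_energy_le_scaled) simp_all
  also have "\<dots> \<le> 1946963/10" by simp
  finally show ?thesis .
qed

lemma min_riesz_2_energy_496: "min_riesz_2_energy 496 \<le> 1808097/5"
proof -
  have "min_riesz_2_energy 496 \<le> scaled_ring_energy 496
    [(3, 3), (15, 9), (39, 15), (74, 20), (119, 25), (174, 30), (237, 33), (306, 36), (380, 38), (457, 39), (535, 39), (612, 38), (686, 36), (755, 33), (818, 30), (873, 25), (918, 20), (953, 15), (977, 9), (989, 3)]"
    by (rule min_riesz_2_energy_le_scaled) simp_all
  also have "\<dots> \<le> 1808097/5" by simp
  finally show ?thesis .
qed

lemma min_riesz_2_energy_less_small:
  assumes "2 \<le> N" "N \<le> 484"
  shows "min_riesz_2_energy N < (real N)\<^sup>2 / 4 * ln (real N)"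
proof -
  let ?below = "\<lambda>n. \<forall>N\<in>{2..n}. min_riesz_2_energy N < (real N)\<^sup>2 / 4 * ln (real N)"
  have "?below 1" by simp
  then have "?below 3"
    by (rule min_riesz_2_energy_less_extend [OF _ min_riesz_2_energy_3, of _ 1 0 0 0]) simp_all
  then have "?below 6"
    by (rule min_riesz_2_energy_less_extend [OF _ min_riesz_2_energy_6, of _ 2 0 0 0]) simp_all
  then have "?below 10"
    by (rule min_riesz_2_energy_less_extend [OF _ min_riesz_2_energy_10, of _ 0 0 0 1]) simp_all
  then have "?below 14"
    by (rule min_riesz_2_energy_less_extend [OF _ min_riesz_2_energy_14, of _ 1 0 1 0]) simp_all
  then have "?below 21"
    by (rule min_riesz_2_energy_less_extend [OF _ min_riesz_2_energy_21, of _ 0 1 1 0]) simp_all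
  then have "?below 28"
    by (rule min_riesz_2_energy_less_extend [OF _ min_riesz_2_energy_28, of _ 0 1 0 1]) simp_all
  then have "?below 39"
    by (rule min_riesz_2_energy_less_extend [OF _ min_riesz_2_energy_39, of _ 2 0 0 1]) simp_all
  then have "?below 55"
    by (rule min_riesz_2_energy_less_extend [OF _ min_riesz_2_energy_55, of _ 3 0 1 0]) simp_all
  then have "?below 78"
    by (rule min_riesz_2_energy_less_extend [OF _ min_riesz_2_energy_78, of _ 3 0 0 1]) simp_all
  then have "?below 104"
    by (rule min_riesz_2_energy_less_extend [OF _ min_riesz_2_energy_104, of _ 0 1 2 0]) simp_all
  then have "?below 146"
    by (rule min_riesz_2_energy_less_extend [OF _ min_riesz_2_energy_146, of _ 0 1 1 1]) simp_all
  then have "?below 204"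
    by (rule min_riesz_2_energy_less_extend [OF _ min_riesz_2_energy_204, of _ 0 1 0 2]) simp_all
  then have "?below 276"
    by (rule min_riesz_2_energy_less_extend [OF _ min_riesz_2_energy_276, of _ 3 0 2 0]) simp_all
  then have "?below 373"
    by (rule min_riesz_2_energy_less_extend [OF _ min_riesz_2_energy_373, of _ 1 3 1 0]) simp_all
  then have "?below 496"
    by (rule min_riesz_2_energy_less_extend [OF _ min_riesz_2_energy_496, of _ 3 2 1 0]) simp_all
  then show ?thesis using assms by simp
qed

section \<open>The minimal energy\<close>

theorem corollary1p4:
  shows "\<exists>C1 C2 :: real. C1 < 0 \<and> C2 < 0 \<and> (\<forall>N :: nat. N \<ge> 2 \<longrightarrow>
    C1 * (real N)\<^sup>2 \<le> min_riesz_2_energy N - 1 / 4 * (real N)\<^sup>2 * ln (real N) \<and>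
    min_riesz_2_energy N - 1 / 4 * (real N)\<^sup>2 * ln (real N) \<le> C2 * (real N)\<^sup>2)"
proof -
  define g where "g N = (min_riesz_2_energy N - 1 / 4 * (real N)\<^sup>2 * ln (real N)) / (real N)\<^sup>2" for N
  \<comment> \<open>For \<open>N > 484\<close> the quotient is at most \<open>- 1 / 400\<close>; each of the finitely many others is negative.\<close>
  define C where "C = Max (insert (- 1 / 400) (g ` {2..484}))"
  have "g N < 0" if "N \<in> {2..484}" for N
    using min_riesz_2_energy_less_small [of N] that by (auto simp: g_def divide_less_0_iff)
  then have "C < 0" unfolding C_def by (subst Max_less_iff) auto
  have upper: "g N \<le> C" if "N \<ge> 2" for N
  proof (cases "N \<le> 484")
    case True
    then show ?thesis unfolding C_def using that by (intro Max_ge) auto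
  next
    case False
    then have "g N \<le> - 1 / 400"
      using min_riesz_2_energy_le_large [of N] by (simp add: g_def pos_divide_le_eq algebra_simps)
    also have "\<dots> \<le> C" unfolding C_def by (intro Max_ge) auto
    finally show ?thesis .
  qed
  have "min_riesz_2_energy N - 1 / 4 * (real N)\<^sup>2 * ln (real N) \<le> C * (real N)\<^sup>2" if "N \<ge> 2" for N
    using upper [OF that] that by (simp add: g_def pos_divide_le_eq)
  moreover have "(- 1 / 4) * (real N)\<^sup>2 \<le> min_riesz_2_energy N - 1 / 4 * (real N)\<^sup>2 * ln (real N)" if "N \<ge> 2" for N
    using min_riesz_2_energy_ge [of N] that by (simp add: algebra_simps)
  ultimately show ?thesis
    using \<open>C < 0\<close> by (intro exI [of _ "- 1 / 4"] exI [of _ C]) auto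
qed

end
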